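(* Let $\boldsymbol\tau,\mathbf o\in\mathbb R^n$ (goal location and obstacle location) and $d_c>0$ satisfy $\|\mathbf o-\boldsymbol\tau\|>2d_c$, let $k_1>0$ and $0<\alpha<1$, and let the initial condition satisfy $\|\mathbf x(t_0)-\mathbf o\|>d_c$. Let $$B(\mathbf x)=\frac{\|\mathbf x-\boldsymbol\tau\|^2}{\|\mathbf x-\mathbf o\|-d_c+\frac1\epsilon},$$ where $\epsilon\gg1$ is a sufficiently large number. Consider the single integrator $\dot{\mathbf x}=\mathbf u$, $\mathbf x,\mathbf u\in\mathbb R^n$, under the control law $$\mathbf u=-k_1\nabla B(\mathbf x)\,\|\nabla B(\mathbf x)\|^{\alpha-1}.$$ Then the point $\mathbf x=\boldsymbol\tau$ is a finite-time-stable equilibrium of the closed-loop system, and the closed-loop trajectories remain safe with respect to the obstacle, i.e. $\|\mathbf x(t)-\mathbf o\|\ge d_c$ for all $t\ge t_0$.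
   Context: $\|\cdot\|$ is the Euclidean norm. The control law is understood as $\mathbf 0$ where $\nabla B=\mathbf 0$. "$\epsilon$ sufficiently large" means: given $\boldsymbol\tau,\mathbf o,d_c,k_1,\alpha$ and the initial condition $\mathbf x(t_0)$, there is $\epsilon_0$ such that the statement holds for every $\epsilon\ge\epsilon_0$. Finite-time stability: consider an autonomous system with equilibrium $\boldsymbol\tau$ on a domain $D\subset\mathbb R^n$ containing $\boldsymbol\tau$, and let $\psi^x$ denote the unique right maximal solution starting at $x$. The equilibrium $\boldsymbol\tau$ is finite-time stable if there exist an open neighborhood $\mathcal N\subset D$ of $\boldsymbol\tau$ and a function $T:\mathcal N\setminus\{\boldsymbol\tau\}\to(0,\infty)$ such that: (1) for every $x\in\mathcal N\setminus\{\boldsymbol\tau\}$, $\psi^x$ is defined on $[0,T(x))$, $\psi^x(t)\in\mathcal N\setminus\{\boldsymbol\tau\}$ for all $t\in[0,T(x))$, and $\lim_{t\to T(x)}\psi^x(t)=\boldsymbol\tau$; (2) for every open neighborhood $U_\epsilon$ of $\boldsymbol\tau$ there is an open subset $U_\delta$ of $\mathcal N$ containing $\boldsymbol\tau$ such that for every $x\in U_\delta\setminus\{\boldsymbol\tau\}$, $\psi^x(t)\in U_\epsilon$ for all $t\in[0,T(x))$. *)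

theory Defs
  imports "HOL-Analysis.Analysis"
begin

definition gradient :: "('a::real_inner \<Rightarrow> real) \<Rightarrow> 'a \<Rightarrow> 'a" where
  "gradient f x = (THE D. GDERIV f x :> D)"

lemma gradient_eqI:
  assumes "GDERIV f x :> D"
  shows "gradient f x = D"
proof -
  have "E = D" if "GDERIV f x :> E" for E
  proof -
    have "(\<lambda>h. h \<bullet> E) = (\<lambda>h. h \<bullet> D)"
      using that assms unfolding gderiv_def by (rule has_derivative_unique)
    then show "E = D"
      by (metis inner_commute vector_eq_rdot)
  qed
  with assms show ?thesis
    unfolding gradient_def by (intro the_equality)
qed

text \<open>
  A solution of \<open>x' = f x\<close> in the domain \<open>D\<close> lives on the half-open interval from \<open>t0\<close> to \<open>b\<close>,
  where \<open>b\<close> may be infinite. Values of \<open>x\<close> outside this interval are irrelevant, and the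
  derivative at \<open>t0\<close> is one-sided.
\<close>

definition right_interval :: "real \<Rightarrow> ereal \<Rightarrow> real set" where
  "right_interval t0 b = {t. t0 \<le> t \<and> ereal t < b}"

definition solution_on ::
  "('a::real_normed_vector \<Rightarrow> 'a) \<Rightarrow> 'a set \<Rightarrow> real \<Rightarrow> 'a \<Rightarrow> ereal \<Rightarrow> (real \<Rightarrow> 'a) \<Rightarrow> bool" where
  "solution_on f D t0 x0 b x \<longleftrightarrow>
     ereal t0 < b \<and> x t0 = x0 \<and>
     (\<forall>t\<in>right_interval t0 b. x t \<in> D \<and>
        (x has_vector_derivative f (x t)) (at t within right_interval t0 b))"

definition right_maximal_solution ::
  "('a::real_normed_vector \<Rightarrow> 'a) \<Rightarrow> 'a set \<Rightarrow> real \<Rightarrow> 'a \<Rightarrow> ereal \<Rightarrow> (real \<Rightarrow> 'a) \<Rightarrow> bool" where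
  "right_maximal_solution f D t0 x0 b x \<longleftrightarrow>
     solution_on f D t0 x0 b x \<and>
     \<not> (\<exists>b' y. b < b' \<and> solution_on f D t0 x0 b' y \<and> (\<forall>t\<in>right_interval t0 b. y t = x t))"

definition unique_right_maximal_solution ::
  "('a::real_normed_vector \<Rightarrow> 'a) \<Rightarrow> 'a set \<Rightarrow> real \<Rightarrow> 'a \<Rightarrow> ereal \<Rightarrow> (real \<Rightarrow> 'a) \<Rightarrow> bool" where
  "unique_right_maximal_solution f D t0 x0 b x \<longleftrightarrow>
     right_maximal_solution f D t0 x0 b x \<and>
     (\<forall>b' y. right_maximal_solution f D t0 x0 b' y \<longrightarrow>
        b' = b \<and> (\<forall>t\<in>right_interval t0 b. y t = x t))"

text \<open>
  In the following definition \<open>\<psi> x\<close>, with right end point \<open>b x\<close>, is the unique right maximal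
  solution starting at \<open>x\<close>. Uniqueness is part of the notion, but only for starting points in the
  neighborhood \<open>N\<close>; a field that is not Lipschitz at another equilibrium may well violate it
  elsewhere in \<open>D\<close>.
\<close>

definition finite_time_stable_equilibrium ::
  "('a::real_normed_vector \<Rightarrow> 'a) \<Rightarrow> 'a set \<Rightarrow> 'a \<Rightarrow> bool" where
  "finite_time_stable_equilibrium f D \<tau> \<longleftrightarrow>
     open D \<and> \<tau> \<in> D \<and> f \<tau> = 0 \<and>
     (\<exists>N T b \<psi>. open N \<and> \<tau> \<in> N \<and> N \<subseteq> D \<and>
        (\<forall>x\<in>N. unique_right_maximal_solution f D 0 x (b x) (\<psi> x)) \<and>
        (\<forall>x\<in>N - {\<tau>}. 0 < T x \<and> ereal (T x) \<le> b x \<and>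
           (\<forall>t\<in>{0..<T x}. \<psi> x t \<in> N - {\<tau>}) \<and>
           (\<psi> x \<longlongrightarrow> \<tau>) (at_left (T x))) \<and>
        (\<forall>U. open U \<and> \<tau> \<in> U \<longrightarrow>
           (\<exists>V. open V \<and> V \<subseteq> N \<and> \<tau> \<in> V \<and>
              (\<forall>x\<in>V - {\<tau>}. \<forall>t\<in>{0..<T x}. \<psi> x t \<in> U))))"

definition barrier :: "'a::real_inner \<Rightarrow> 'a \<Rightarrow> real \<Rightarrow> real \<Rightarrow> 'a \<Rightarrow> real" where
  "barrier \<tau> obs dc \<epsilon> x = (norm (x - \<tau>))\<^sup>2 / (norm (x - obs) - dc + 1 / \<epsilon>)"

text \<open>
  The closed loop is considered where \<open>barrier\<close> is defined and smooth, that is, away from the zeros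
  of its denominator and from the kink of the norm at \<open>obs\<close>. The domain includes unsafe points,
  so that safety is not built into the notion of a trajectory.
\<close>

definition closed_loop_domain :: "'a::real_inner \<Rightarrow> real \<Rightarrow> real \<Rightarrow> 'a set" where
  "closed_loop_domain obs dc \<epsilon> = {x. x \<noteq> obs \<and> norm (x - obs) - dc + 1 / \<epsilon> \<noteq> 0}"

definition control_law ::
  "real \<Rightarrow> real \<Rightarrow> 'a::real_inner \<Rightarrow> 'a \<Rightarrow> real \<Rightarrow> real \<Rightarrow> 'a \<Rightarrow> 'a" where
  "control_law k1 \<alpha> \<tau> obs dc \<epsilon> x =
     (let g = gradient (barrier \<tau> obs dc \<epsilon>) x
      in if g = 0 then 0 else - (k1 * norm g powr (\<alpha> - 1)) *\<^sub>R g)"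

end

theory Submission
  imports Defs "HOL-Complex_Analysis.Great_Picard"
begin

text \<open>
  Along trajectories the barrier \<open>B\<close> decreases at the rate \<open>k1 * norm (\<nabla>B) powr (\<alpha> + 1)\<close>, and for
  large \<open>\<epsilon>\<close> its values on the obstacle boundary exceed its initial value. A trajectory starting in
  the safe region is therefore trapped in a compact set of safe points; this gives safety and, with
  Peano's theorem, global existence.

  Near the goal the gradient inequality \<open>B \<le> m * (norm (\<nabla>B))\<^sup>2\<close> turns the decay into
  \<open>B' \<le> - \<kappa> * B powr ((\<alpha> + 1) / 2)\<close> with an exponent below \<open>1\<close>, so \<open>B\<close> vanishes in finite time.
  Uniqueness near the goal, where the field is not Lipschitz, holds because it is locally Lipschitz
  away from the goal and the goal itself is absorbing.
\<close>

subsection \<open>Peano existence for bounded continuous fields\<close>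

text \<open>Let \<open>q = norm (x - \<tau>) / den x\<close>, where \<open>den x\<close> is the
  denominator of \<open>B\<close>. Then \<open>B x = q^2 * den x\<close>, and where
  \<open>den x\<close> is positive the gradient is a difference of two vectors of lengths
  \<open>2 * q\<close> and \<open>q^2\<close>. As long as \<open>q \<le> 1\<close> it cannot be
  shorter than \<open>q\<close>, and a bound on \<open>den\<close> turns this into the gradient
  inequality. The neighborhood of the goal is chosen to force \<open>q \<le> 1\<close>.

  Such a restriction is unavoidable: on the ray from \<tau> through \<open>obs\<close>, beyond the
  obstacle, there is a safe point with \<open>q = 2\<close> at which the two vectors cancel. The
  field has a further equilibrium there, and the Lipschitz argument for uniqueness breaks down. For
  a general safe starting point one therefore has existence only, so safety and global existence are
  proved for every right maximal solution, by compactness and the decrease of \<open>B\<close>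
  alone. Uniqueness is confined to the neighborhood of the goal.\<close>

lemma at_within_atLeast_eq_Icc:
  fixes t :: real
  assumes "t < u"
  shows "at t within {a..} = at t within {a..u}"
  by (rule at_within_nhd[where S = "{..<u}"]) (use assms in auto)

lemma integral_lipschitz:
  fixes g :: "real \<Rightarrow> 'a::euclidean_space"
  assumes "continuous_on UNIV g" and "\<And>s. norm (g s) \<le> M"
  shows "M-lipschitz_on UNIV (\<lambda>t. integral {0..t} g)"
proof -
  have "0 \<le> M"
    using assms(2)[of 0] norm_ge_zero order_trans by blast
  have int: "g integrable_on {a..b}" for a b :: real
    by (rule integrable_continuous_real) (rule continuous_on_subset[OF assms(1)], simp)
  have *: "norm (integral {0..t} g - integral {0..s} g) \<le> M * \<bar>t - s\<bar>" if "s \<le> t" for s t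
  proof -
    \<comment> \<open>For a negative end point \<open>{0..t}\<close> is empty and the integral is 0,
      so clamping at 0 changes nothing. The estimate is wanted on the whole line because delayed
      curves are evaluated at negative times.\<close>
    define s' where "s' = max 0 s"
    define t' where "t' = max 0 t"
    have "integral {0..t} g = integral {0..t'} g" "integral {0..s} g = integral {0..s'} g"
      by (auto simp: s'_def t'_def max_def)
    moreover have "integral {0..t'} g - integral {0..s'} g = integral {s'..t'} g"
      using Henstock_Kurzweil_Integration.integral_combine[of 0 s' t' g] int that
      by (auto simp: s'_def t'_def algebra_simps)
    moreover have "norm (integral {s'..t'} g) \<le> M * (t' - s')"
      using that assms
      by (intro integral_bound) (auto intro: continuous_on_subset simp: s'_def t'_def)
    moreover have "M * (t' - s') \<le> M * \<bar>t - s\<bar>"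
      using \<open>0 \<le> M\<close> that by (intro mult_left_mono) (auto simp: s'_def t'_def)
    ultimately show ?thesis by simp
  qed
  show ?thesis
  proof (rule lipschitz_onI)
    fix s t :: real
    show "dist (integral {0..s} g) (integral {0..t} g) \<le> M * dist s t"
      using *[of s t] *[of t s]
      by (cases "s \<le> t") (auto simp: dist_norm dist_real_def norm_minus_commute abs_minus_commute)
  qed fact
qed

text \<open>A pointwise form of Arzela-Ascoli: a diagonal sequence converges at all rational times,
  and the common Lipschitz constant carries the Cauchy property from a nearby rational to any
  time.\<close>

lemma equi_lipschitz_convergent_subsequence:
  fixes x :: "nat \<Rightarrow> real \<Rightarrow> 'a::euclidean_space"
  assumes lip: "\<And>m. M-lipschitz_on UNIV (x m)" and x0: "\<And>m. x m 0 = p"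
  obtains k y where "strict_mono (k::nat \<Rightarrow> nat)" "\<And>t. (\<lambda>n. x (k n) t) \<longlonglongrightarrow> y t"
    "M-lipschitz_on UNIV y"
proof -
  have "0 \<le> M"
    using lip[of 0] by (rule lipschitz_on_nonneg)
  have dst: "dist (x m s) (x m t) \<le> M * dist s t" for m s t
    using lip by (rule lipschitz_onD) auto
  \<comment> \<open>The diagonal principle asks for one bound at all times. The curves grow at most
    linearly, so dividing by \<open>1 + \<bar>t\<bar>\<close> provides it.\<close>
  have bd: "norm (x m t /\<^sub>R (1 + \<bar>t\<bar>)) \<le> norm p + M" for m t
  proof -
    have "norm (x m t) \<le> norm p + M * \<bar>t\<bar>"
      using dst[of m t 0] norm_triangle_ineq2[of "x m t" p]
      by (simp add: x0 dist_norm)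
    also have "\<dots> \<le> (norm p + M) * (1 + \<bar>t\<bar>)"
      using \<open>0 \<le> M\<close> by (simp add: algebra_simps)
    finally show ?thesis
      by (simp add: divide_simps mult.commute)
  qed
  obtain k where k: "strict_mono (k::nat \<Rightarrow> nat)"
    "\<And>t. t \<in> \<rat> \<Longrightarrow> \<exists>l. (\<lambda>n. x (k n) t /\<^sub>R (1 + \<bar>t\<bar>)) \<longlonglongrightarrow> l"
    using function_convergent_subsequence[of \<rat> "\<lambda>m t. x m t /\<^sub>R (1 + \<bar>t\<bar>)", OF countable_rat bd]
    by metis
  have rat: "Cauchy (\<lambda>n. x (k n) q)" if "q \<in> \<rat>" for q
  proof -
    obtain l where "(\<lambda>n. x (k n) q /\<^sub>R (1 + \<bar>q\<bar>)) \<longlonglongrightarrow> l"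
      using k(2) \<open>q \<in> \<rat>\<close> by blast
    then have "(\<lambda>n. (1 + \<bar>q\<bar>) *\<^sub>R (x (k n) q /\<^sub>R (1 + \<bar>q\<bar>))) \<longlonglongrightarrow> (1 + \<bar>q\<bar>) *\<^sub>R l"
      by (intro tendsto_intros)
    moreover have "(1 + \<bar>q\<bar>) *\<^sub>R (x (k n) q /\<^sub>R (1 + \<bar>q\<bar>)) = x (k n) q" for n
      by (simp add: add_nonneg_eq_0_iff)
    ultimately show ?thesis
      by (auto intro: convergent_Cauchy convergentI)
  qed
  have "Cauchy (\<lambda>n. x (k n) t)" for t
  proof (rule metric_CauchyI)
    fix e :: real assume "0 < e"
    \<comment> \<open>\<open>M + 1\<close> instead of \<open>M\<close> keeps the interval nonempty
      when \<open>M = 0\<close>.\<close>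
    obtain q where q: "q \<in> \<rat>" "t < q" "q < t + e / (3 * (M + 1))"
      using Rats_dense_in_real[of t "t + e / (3 * (M + 1))"] \<open>0 < e\<close> \<open>0 \<le> M\<close> by auto
    have close: "dist (x m t) (x m q) < e / 3" for m
    proof -
      have "dist (x m t) (x m q) \<le> M * (q - t)"
        using dst[of m t q] q by (simp add: dist_real_def)
      also have "\<dots> \<le> (M + 1) * (q - t)"
        using q by (intro mult_right_mono) auto
      also have "\<dots> < e / 3"
        using q \<open>0 \<le> M\<close> by (simp add: field_simps)
      finally show ?thesis .
    qed
    obtain N where N: "dist (x (k m) q) (x (k n) q) < e / 3" if "N \<le> m" "N \<le> n" for m n
      using rat[OF q(1)] \<open>0 < e\<close> unfolding Cauchy_def by (metis divide_pos_pos zero_less_numeral)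
    show "\<exists>N. \<forall>m\<ge>N. \<forall>n\<ge>N. dist (x (k m) t) (x (k n) t) < e"
    proof (intro exI allI impI)
      fix m n assume "N \<le> m" "N \<le> n"
      then show "dist (x (k m) t) (x (k n) t) < e"
        using N[of m n] close[of "k m"] close[of "k n"]
          dist_triangle[of "x (k m) t" "x (k n) t" "x (k m) q"]
          dist_triangle[of "x (k m) q" "x (k n) t" "x (k n) q"]
        by (simp add: dist_commute)
    qed
  qed
  then have "\<forall>t. \<exists>l. (\<lambda>n. x (k n) t) \<longlonglongrightarrow> l"
    using Cauchy_convergent_iff convergent_def by blast
  then obtain y where y: "\<And>t. (\<lambda>n. x (k n) t) \<longlonglongrightarrow> y t"
    by metis
  moreover have "M-lipschitz_on UNIV y"
  proof (rule lipschitz_onI)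
    fix s t
    show "dist (y s) (y t) \<le> M * dist s t"
      by (rule tendsto_upperbound[OF tendsto_dist[OF y y]]) (use dst in auto)
  qed fact
  ultimately show ?thesis
    using that k(1) by blast
qed

text \<open>
  Tonelli's proof: delaying the right-hand side by \<open>h\<close> makes the integral equation explicit, and
  iterating the integral operator \<open>k\<close> times solves the delayed equation up to time \<open>k * h\<close>.
\<close>

lemma Peano_bounded_continuous:
  fixes F :: "'a::euclidean_space \<Rightarrow> 'a"
  assumes contF: "continuous_on UNIV F" and bdF: "\<And>z. norm (F z) \<le> M"
  obtains x where "x 0 = p"
    "\<And>t. 0 \<le> t \<Longrightarrow> (x has_vector_derivative F (x t)) (at t within {0..})"
proof -
  define \<Phi> where "\<Phi> h y t = p + integral {0..t} (\<lambda>s. F (y (s - h)))" for h :: real and y t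
  have "0 \<le> M"
    using bdF[of 0] norm_ge_zero order_trans by blast
  have cont: "continuous_on A (\<lambda>s. F (y (s - h)))" if "continuous_on UNIV y" for y A and h :: real
  proof -
    have "continuous_on A (\<lambda>s. y (s - h))"
      by (rule continuous_on_compose2[OF that]) (auto intro!: continuous_intros)
    then show ?thesis
      by (rule continuous_on_compose2[OF contF]) auto
  qed
  have \<Phi>_lip: "M-lipschitz_on UNIV (\<Phi> h y)" if "continuous_on UNIV y" for y h
  proof -
    have "M-lipschitz_on UNIV (\<lambda>t. integral {0..t} (\<lambda>s. F (y (s - h))))"
      using cont[OF that] bdF by (rule integral_lipschitz)
    from lipschitz_on_add[OF lipschitz_on_constant[of _ p] this]
    show ?thesis by (simp add: \<Phi>_def[abs_def])
  qed
  have iter_lip: "M-lipschitz_on UNIV ((\<Phi> h ^^ k) (\<lambda>_. p))" for h k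
  proof (induction k)
    case 0
    show ?case
      using \<open>0 \<le> M\<close> by (auto intro!: lipschitz_onI)
  next
    case (Suc k)
    then show ?case
      using \<Phi>_lip[OF lipschitz_on_continuous_on] by simp
  qed
  have stab: "\<Phi> h ((\<Phi> h ^^ k) (\<lambda>_. p)) t = (\<Phi> h ^^ k) (\<lambda>_. p) t" if "t \<le> real k * h" for h k t
    using that
  proof (induction k arbitrary: t)
    case 0
    then show ?case by (cases "t = 0") (auto simp: \<Phi>_def)
  next
    case (Suc k)
    \<comment> \<open>The value at \<open>t\<close> depends on the argument only up to time
      \<open>t - h\<close>, so each iteration extends the agreement by \<open>h\<close>.\<close>
    have "\<Phi> h u t = \<Phi> h v t" if "\<And>s. s \<in> {0..t} \<Longrightarrow> u (s - h) = v (s - h)" for u v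
      unfolding \<Phi>_def by (intro arg_cong[of _ _ "(+) p"] integral_cong arg_cong[of _ _ F] that)
    then have "\<Phi> h (\<Phi> h ((\<Phi> h ^^ k) (\<lambda>_. p))) t = \<Phi> h ((\<Phi> h ^^ k) (\<lambda>_. p)) t"
    proof this
      fix s assume "s \<in> {0..t}"
      with Suc.prems show "\<Phi> h ((\<Phi> h ^^ k) (\<lambda>_. p)) (s - h) = (\<Phi> h ^^ k) (\<lambda>_. p) (s - h)"
        by (intro Suc.IH) (simp add: algebra_simps)
    qed
    then show ?case
      by simp
  qed
  define h where "h m = 1 / real (Suc m)" for m
  \<comment> \<open>With delay \<open>1 / (m + 1)\<close>, \<open>(m + 1)^2\<close> iterations reach
    time \<open>m + 1\<close>, so every fixed time is eventually covered.\<close>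
  define x where "x m = (\<Phi> (h m) ^^ (Suc m * Suc m)) (\<lambda>_. p)" for m
  have x_lip: "M-lipschitz_on UNIV (x m)" for m
    unfolding x_def by (rule iter_lip)
  have x_eq: "x m t = \<Phi> (h m) (x m) t" if "t \<le> real (Suc m)" for m t
    unfolding x_def using that
    by (intro stab[symmetric]) (simp add: h_def del: of_nat_Suc mult_Suc mult_Suc_right)
  have x_0: "x m 0 = p" for m
    using x_eq[of 0 m] by (simp add: \<Phi>_def)
  obtain k y where k: "strict_mono (k::nat \<Rightarrow> nat)" and y: "\<And>t. (\<lambda>n. x (k n) t) \<longlonglongrightarrow> y t"
    and y_lip: "M-lipschitz_on UNIV y"
    by (rule equi_lipschitz_convergent_subsequence[where x = x, OF x_lip x_0]) (rule that, assumption+)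
  have y_cont: "continuous_on A y" for A
    using lipschitz_on_continuous_on[OF y_lip] continuous_on_subset by blast
  have Fy_cont: "continuous_on A (\<lambda>s. F (y s))" for A
    using cont[OF y_cont, of A 0] by simp
  have h0: "(\<lambda>n. h (k n)) \<longlonglongrightarrow> 0"
  proof -
    have "h \<longlonglongrightarrow> 0"
      using LIMSEQ_inverse_real_of_nat by (simp add: h_def[abs_def] inverse_eq_divide)
    from LIMSEQ_subseq_LIMSEQ[OF this k] show ?thesis
      by (simp add: o_def)
  qed
  have delayed: "(\<lambda>n. x (k n) (s - h (k n))) \<longlonglongrightarrow> y s" for s
  proof -
    have "(\<lambda>n. x (k n) (s - h (k n)) - x (k n) s) \<longlonglongrightarrow> 0"
    proof (rule Lim_null_comparison)
      show "\<forall>\<^sub>F n in sequentially. norm (x (k n) (s - h (k n)) - x (k n) s) \<le> M * h (k n)"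
      proof (intro always_eventually allI)
        fix n
        show "norm (x (k n) (s - h (k n)) - x (k n) s) \<le> M * h (k n)"
          using lipschitz_onD[OF x_lip, of "s - h (k n)" s "k n"]
          by (simp add: dist_norm dist_real_def h_def)
      qed
      show "(\<lambda>n. M * h (k n)) \<longlonglongrightarrow> 0"
        using tendsto_mult_left[OF h0, of M] by simp
    qed
    from tendsto_add[OF this y[of s]] show ?thesis by simp
  qed
  have int_eq: "y t = p + integral {0..t} (\<lambda>s. F (y s))" if "0 \<le> t" for t
  proof -
    have "(\<lambda>n. integral {0..t} (\<lambda>s. F (x (k n) (s - h (k n))))) \<longlonglongrightarrow>
        integral {0..t} (\<lambda>s. F (y s))"
    proof (rule dominated_convergence)
      show "(\<lambda>s. F (x (k n) (s - h (k n)))) integrable_on {0..t}" for n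
        by (intro integrable_continuous_real cont lipschitz_on_continuous_on[OF x_lip])
      show "(\<lambda>_. M) integrable_on {0..t}"
        by (intro integrable_continuous_real continuous_on_const)
      show "(\<lambda>n. F (x (k n) (s - h (k n)))) \<longlonglongrightarrow> F (y s)" for s
        using contF delayed[of s]
        by (rule continuous_on_tendsto_compose) auto
    qed (rule bdF)
    then have "(\<lambda>n. \<Phi> (h (k n)) (x (k n)) t) \<longlonglongrightarrow> p + integral {0..t} (\<lambda>s. F (y s))"
      unfolding \<Phi>_def by (intro tendsto_intros)
    moreover have "\<forall>\<^sub>F n in sequentially. \<Phi> (h (k n)) (x (k n)) t = x (k n) t"
    proof -
      obtain N :: nat where N: "t \<le> real N"
        using real_arch_simple by blast
      have "\<Phi> (h (k n)) (x (k n)) t = x (k n) t" if "N \<le> n" for n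
        using seq_suble[OF k, of n] that N by (intro x_eq[symmetric]) linarith
      then show ?thesis
        by (auto simp: eventually_sequentially)
    qed
    ultimately have "(\<lambda>n. x (k n) t) \<longlonglongrightarrow> p + integral {0..t} (\<lambda>s. F (y s))"
      by (simp add: tendsto_cong)
    with y[of t] show ?thesis
      by (rule LIMSEQ_unique)
  qed
  show ?thesis
  proof
    show "y 0 = p"
      using int_eq[of 0] by simp
    fix t :: real assume "0 \<le> t"
    have "((\<lambda>u. p + integral {0..u} (\<lambda>s. F (y s))) has_vector_derivative F (y t))
        (at t within {0..t + 1})"
      using integral_has_vector_derivative[OF Fy_cont, of t 0 "t + 1"] \<open>0 \<le> t\<close>
      by (auto intro!: derivative_eq_intros)
    then have "(y has_vector_derivative F (y t)) (at t within {0..t + 1})"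
      using \<open>0 \<le> t\<close> by (rule_tac has_vector_derivative_transform[of _ _ y]) (auto simp: int_eq)
    then show "(y has_vector_derivative F (y t)) (at t within {0..})"
      by (simp add: at_within_atLeast_eq_Icc[of t "t + 1"])
  qed
qed

subsection \<open>Continuation and uniqueness of solutions\<close>

lemma right_interval_infinity [simp]: "right_interval t0 \<infinity> = {t0..}"
  by (auto simp: right_interval_def)

lemma right_interval_real [simp]: "right_interval t0 (ereal b) = {t0..<b}"
  by (auto simp: right_interval_def)

lemma solution_on_has_vector_derivative_at:
  assumes "solution_on f D t0 x0 b x" "t0 < t" "ereal t < b"
  shows "(x has_vector_derivative f (x t)) (at t)"
proof -
  \<comment> \<open>A real \<open>c\<close> between \<open>t\<close> and \<open>b\<close> gives an
    open real interval around \<open>t\<close> even when \<open>b\<close> is infinite.\<close>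
  obtain c where c: "t < c" "ereal c < b"
    using ereal_dense2[OF assms(3)] by auto
  have "{t0<..<c} \<subseteq> right_interval t0 b"
    using c(2) by (auto simp: right_interval_def intro: less_trans[of _ "ereal c"])
  moreover have "(x has_vector_derivative f (x t)) (at t within right_interval t0 b)"
    using assms by (auto simp: solution_on_def right_interval_def)
  ultimately have "(x has_vector_derivative f (x t)) (at t within {t0<..<c})"
    by (rule has_vector_derivative_within_subset[rotated])
  then show ?thesis
    using assms(2) c(1) by (simp add: at_within_open[of t "{t0<..<c}"])
qed

lemma solution_on_continuous_on:
  assumes "solution_on f D t0 x0 b x"
  shows "continuous_on (right_interval t0 b) x"
  using assms by (auto simp: solution_on_def continuous_on_eq_continuous_within
      intro: has_vector_derivative_continuous)

text \<open>\<open>b\<close> is a time at which two pieces are glued. The integral equation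
  tolerates one exceptional point, and since its integrand is continuous, differentiating it returns
  the derivative at \<open>b\<close> and the one-sided derivative at \<open>t0\<close>.\<close>

lemma solution_on_infinityI:
  fixes y :: "real \<Rightarrow> 'a::euclidean_space"
  assumes y0: "y t0 = x0" and D: "\<And>t. t0 \<le> t \<Longrightarrow> y t \<in> D"
    and cont: "continuous_on {t0..} y" and contf: "continuous_on D f"
    and der: "\<And>t. t0 < t \<Longrightarrow> t \<noteq> b \<Longrightarrow> (y has_vector_derivative f (y t)) (at t)"
  shows "solution_on f D t0 x0 \<infinity> y"
proof -
  have cont_fy: "continuous_on {t0..} (\<lambda>t. f (y t))"
    by (rule continuous_on_compose2[OF contf cont]) (use D in auto)
  have eq: "y t0 + integral {t0..t} (\<lambda>t. f (y t)) = y t" if "t0 \<le> t" for t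
  proof -
    have "((\<lambda>t. f (y t)) has_integral y t - y t0) {t0..t}"
      using that der by (intro fundamental_theorem_of_calculus_interior_strong[of "{b}"]
          continuous_on_subset[OF cont]) auto
    then show ?thesis
      by (simp add: integral_unique)
  qed
  have "(y has_vector_derivative f (y t)) (at t within {t0..})" if "t0 \<le> t" for t
  proof -
    have "continuous_on {t0..t + 1} (\<lambda>t. f (y t))"
      by (rule continuous_on_subset[OF cont_fy]) auto
    then have "((\<lambda>u. y t0 + integral {t0..u} (\<lambda>t. f (y t))) has_vector_derivative f (y t))
        (at t within {t0..t + 1})"
      using integral_has_vector_derivative[of t0 "t + 1" _ t] that
      by (auto intro!: derivative_eq_intros)
    then have "(y has_vector_derivative f (y t)) (at t within {t0..t + 1})"
      by (rule has_vector_derivative_transform[rotated 2]) (use that eq in auto)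
    then show ?thesis
      by (simp add: at_within_atLeast_eq_Icc[of t "t + 1"])
  qed
  then show ?thesis
    using y0 D by (simp add: solution_on_def)
qed

text \<open>Confinement to a compact set bounds the speed, so the solution is Lipschitz and extends
  continuously to \<open>b\<close>. The limit still lies in \<open>K\<close>, where a restart is
  available.\<close>

lemma solution_on_extend_infinity:
  fixes x :: "real \<Rightarrow> 'a::euclidean_space"
  assumes sol: "solution_on f D t0 x0 (ereal b) x"
    and K: "compact K" "K \<subseteq> D" "\<And>t. t \<in> {t0..<b} \<Longrightarrow> x t \<in> K"
    and contf: "continuous_on D f"
    and restart: "\<And>q. q \<in> K \<Longrightarrow> \<exists>z. solution_on f D b q \<infinity> z"
  shows "\<exists>y. solution_on f D t0 x0 \<infinity> y \<and> (\<forall>t\<in>{t0..<b}. y t = x t)"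
proof -
  have "t0 < b" "x t0 = x0"
    and der: "\<And>t. t \<in> {t0..<b} \<Longrightarrow> (x has_vector_derivative f (x t)) (at t within {t0..<b})"
    using sol by (auto simp: solution_on_def)
  have "bounded (f ` K)"
    by (intro compact_imp_bounded compact_continuous_image continuous_on_subset[OF contf] K)
  then obtain M where M: "\<And>q. q \<in> K \<Longrightarrow> norm (f q) \<le> M"
    unfolding bounded_iff by blast
  have "0 \<le> M"
    using order_trans[OF norm_ge_zero M[OF K(3)[of t0]]] \<open>t0 < b\<close> by simp
  have "M-lipschitz_on {t0..<b} x"
  proof (rule bounded_derivative_imp_lipschitz[where f' = "\<lambda>t h. h *\<^sub>R f (x t)"])
    show "(x has_derivative (\<lambda>h. h *\<^sub>R f (x t))) (at t within {t0..<b})" if "t \<in> {t0..<b}" for t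
      using der[OF that] by (simp add: has_vector_derivative_def)
    show "onorm (\<lambda>h::real. h *\<^sub>R f (x t)) \<le> M" if "t \<in> {t0..<b}" for t
      using onorm_scaleR_left[OF bounded_linear_ident, of "f (x t)"] M[OF K(3)[OF that]]
      by (simp add: onorm_id)
  qed (use \<open>0 \<le> M\<close> in auto)
  then have "uniformly_continuous_on {t0..<b} x"
    by (rule lipschitz_on_uniformly_continuous)
  then obtain g where "uniformly_continuous_on (closure {t0..<b}) g"
    and g: "\<And>t. t \<in> {t0..<b} \<Longrightarrow> x t = g t"
    by (rule uniformly_continuous_on_extension_on_closure) (rule that, assumption+)
  then have contg: "continuous_on {t0..b} g"
    using \<open>t0 < b\<close> by (simp add: uniformly_continuous_imp_continuous)
  have "g ` closure {t0..<b} \<subseteq> K"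
    using K g contg \<open>t0 < b\<close>
    by (intro image_closure_subset) (auto simp: compact_imp_closed)
  then have gK: "g t \<in> K" if "t \<in> {t0..b}" for t
    using that \<open>t0 < b\<close> by auto
  obtain z where z: "solution_on f D b (g b) \<infinity> z"
    using restart gK[of b] \<open>t0 < b\<close> by auto
  then have zb: "z b = g b" and contz: "continuous_on {b..} z" and zD: "\<And>t. b \<le> t \<Longrightarrow> z t \<in> D"
    using solution_on_continuous_on[OF z] by (auto simp: solution_on_def)
  define y where "y t = (if t \<le> b then g t else z t)" for t
  have "solution_on f D t0 x0 \<infinity> y"
  proof (rule solution_on_infinityI[OF _ _ _ contf])
    show "y t0 = x0"
      using \<open>t0 < b\<close> \<open>x t0 = x0\<close> g[of t0] by (simp add: y_def)
    show "y t \<in> D" if "t0 \<le> t" for t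
      using that gK K(2) zD by (auto simp: y_def)
    show "continuous_on {t0..} y"
      unfolding y_def
    proof (rule continuous_on_cases_1)
      show "continuous_on {t \<in> {t0..}. t \<le> b} g"
        by (rule continuous_on_subset[OF contg]) auto
      show "continuous_on {t \<in> {t0..}. b \<le> t} z"
        by (rule continuous_on_subset[OF contz]) auto
    qed (simp add: zb)
    fix t assume "t0 < t" "t \<noteq> b"
    show "(y has_vector_derivative f (y t)) (at t)"
    proof (cases "t < b")
      case True
      then have "(x has_vector_derivative f (x t)) (at t)"
        using solution_on_has_vector_derivative_at[OF sol \<open>t0 < t\<close>] by simp
      then have "(y has_vector_derivative f (x t)) (at t)"
        by (rule has_vector_derivative_transform_within_open[of _ _ _ "{t0<..<b}"])
          (use True \<open>t0 < t\<close> g in \<open>auto simp: y_def\<close>)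
      then show ?thesis
        using g[of t] True \<open>t0 < t\<close> by (simp add: y_def)
    next
      case False
      then have "(z has_vector_derivative f (z t)) (at t)"
        using solution_on_has_vector_derivative_at[OF z, of t] \<open>t \<noteq> b\<close> by simp
      then have "(y has_vector_derivative f (z t)) (at t)"
        by (rule has_vector_derivative_transform_within_open[of _ _ _ "{b<..}"])
          (use False \<open>t \<noteq> b\<close> in \<open>auto simp: y_def\<close>)
      then show ?thesis
        using False \<open>t \<noteq> b\<close> by (simp add: y_def)
    qed
  qed
  then show ?thesis
    using g by (auto simp: y_def)
qed

text \<open>Gronwall's argument: the squared distance, discounted by
  \<open>exp (- 2 * L * t)\<close>, cannot grow. Derivatives are asked for only inside the interval,
  which admits a start where the derivative is one-sided.\<close>

lemma lipschitz_solutions_agree: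
  fixes x y :: "real \<Rightarrow> 'a::real_inner"
  assumes "a \<le> b" and lip: "L-lipschitz_on U f"
    and cont: "continuous_on {a..b} x" "continuous_on {a..b} y"
    and U: "\<And>t. t \<in> {a<..<b} \<Longrightarrow> x t \<in> U \<and> y t \<in> U"
    and derx: "\<And>t. t \<in> {a<..<b} \<Longrightarrow> (x has_vector_derivative f (x t)) (at t)"
    and dery: "\<And>t. t \<in> {a<..<b} \<Longrightarrow> (y has_vector_derivative f (y t)) (at t)"
    and "x a = y a"
  shows "x b = y b"
proof -
  define u where "u t = (x t - y t) \<bullet> (x t - y t) * exp (- 2 * L * t)" for t
  have "u b \<le> u a"
  proof (rule DERIV_nonpos_imp_decreasing_open[OF \<open>a \<le> b\<close>])
    show "continuous_on {a..b} u"
      unfolding u_def by (intro continuous_intros cont)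
    fix t assume "a < t" "t < b"
    then have t: "t \<in> {a<..<b}" by simp
    have "((\<lambda>t. x t - y t) has_derivative (\<lambda>h. h *\<^sub>R (f (x t) - f (y t)))) (at t)"
      using has_vector_derivative_diff[OF derx[OF t] dery[OF t]]
      by (simp add: has_vector_derivative_def)
    from has_derivative_inner[OF this this]
    have "((\<lambda>t. (x t - y t) \<bullet> (x t - y t)) has_field_derivative
        2 * ((x t - y t) \<bullet> (f (x t) - f (y t)))) (at t)"
      unfolding has_field_derivative_def
      by (rule has_derivative_eq_rhs) (auto simp: inner_commute)
    then have "(u has_field_derivative (2 * ((x t - y t) \<bullet> (f (x t) - f (y t))) * exp (- 2 * L * t)
        + (exp (- 2 * L * t) * (- 2 * L)) * ((x t - y t) \<bullet> (x t - y t)))) (at t)"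
      unfolding u_def by (intro DERIV_mult) (auto intro!: derivative_eq_intros)
    moreover have "(x t - y t) \<bullet> (f (x t) - f (y t)) \<le> L * ((x t - y t) \<bullet> (x t - y t))"
    proof -
      have "(x t - y t) \<bullet> (f (x t) - f (y t)) \<le> norm (x t - y t) * norm (f (x t) - f (y t))"
        by (rule norm_cauchy_schwarz)
      also have "\<dots> \<le> norm (x t - y t) * (L * norm (x t - y t))"
        using lipschitz_onD[OF lip, of "x t" "y t"] U[OF t]
        by (intro mult_left_mono) (auto simp: dist_norm)
      finally show ?thesis
        by (simp add: power2_norm_eq_inner[symmetric] power2_eq_square mult_ac)
    qed
    then have "exp (- 2 * L * t) * (2 * ((x t - y t) \<bullet> (f (x t) - f (y t))))
        \<le> exp (- 2 * L * t) * (2 * (L * ((x t - y t) \<bullet> (x t - y t))))"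
      by (intro mult_left_mono) auto
    then have "2 * ((x t - y t) \<bullet> (f (x t) - f (y t))) * exp (- 2 * L * t)
        + (exp (- 2 * L * t) * (- 2 * L)) * ((x t - y t) \<bullet> (x t - y t)) \<le> 0"
      by (simp add: algebra_simps)
    ultimately show "\<exists>d. DERIV u t :> d \<and> d \<le> 0" by blast
  qed
  also have "u a = 0"
    by (simp add: u_def \<open>x a = y a\<close>)
  finally have "(x b - y b) \<bullet> (x b - y b) \<le> 0"
    by (simp add: u_def mult_le_0_iff)
  then show ?thesis
    by (simp add: power2_norm_eq_inner[symmetric])
qed

text \<open>
  The first alternative in \<open>loc\<close> covers points where the field is not Lipschitz, such as an absorbing
  equilibrium.
\<close>

lemma solution_on_infinity_unique:
  fixes x y :: "real \<Rightarrow> 'a::real_inner"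
  assumes x: "solution_on f D t0 x0 \<infinity> x" and y: "solution_on f D t0 x0 \<infinity> y"
    and loc: "\<And>t. t0 \<le> t \<Longrightarrow> x t = y t \<Longrightarrow>
      (\<forall>s\<ge>t. x s = y s) \<or> (\<exists>L U. open U \<and> x t \<in> U \<and> L-lipschitz_on U f)"
    and "t0 \<le> t"
  shows "x t = y t"
proof (rule ccontr)
  assume neq: "x t \<noteq> y t"
  have cont: "continuous_on {t0..} x" "continuous_on {t0..} y"
    using solution_on_continuous_on[OF x] solution_on_continuous_on[OF y] by auto
  have cont': "continuous_on A x" "continuous_on A y" if "A \<subseteq> {t0..}" for A
    using continuous_on_subset[OF cont(1) that] continuous_on_subset[OF cont(2) that] .
  define A where "A = {s \<in> {t0..t}. x s - y s = 0}"
  have "compact A"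
    unfolding A_def
    by (rule closedin_compact[OF compact_Icc continuous_closedin_preimage_constant])
      (intro continuous_intros cont'; auto)
  moreover have "t0 \<in> A"
    using x y \<open>t0 \<le> t\<close> by (auto simp: A_def solution_on_def)
  \<comment> \<open>\<open>r\<close> is the last time of agreement up to \<open>t\<close>. The first
    alternative of \<open>loc\<close> at \<open>r\<close> contradicts \<open>neq\<close>, and the
    second one extends the agreement beyond \<open>r\<close>.\<close>
  ultimately obtain r where r: "r \<in> A" and max: "\<And>s. s \<in> A \<Longrightarrow> s \<le> r"
    using compact_attains_sup[of A] by auto
  have r': "t0 \<le> r" "r < t" "x r = y r"
    using r neq by (auto simp: A_def order.order_iff_strict)
  then obtain L U where U: "open U" "x r \<in> U" and lip: "L-lipschitz_on U f"
    using loc[of r] neq by (metis less_imp_le)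
  have ev: "\<forall>\<^sub>F s in at_right r. w s \<in> U" if "continuous_on {t0..} w" "w r \<in> U" for w
  proof -
    have "(w \<longlongrightarrow> w r) (at r within {t0..})"
      using that r' by (auto simp: continuous_on_def)
    then have "(w \<longlongrightarrow> w r) (at_right r)"
      by (rule tendsto_within_subset) (use r' in auto)
    then show ?thesis
      using U(1) that(2) by (rule topological_tendstoD)
  qed
  have "\<forall>\<^sub>F s in at_right r. x s \<in> U \<and> y s \<in> U"
    using ev[OF cont(1)] ev[OF cont(2)] U r' by (simp add: eventually_conj)
  then obtain c where c: "r < c" "\<And>s. r < s \<Longrightarrow> s < c \<Longrightarrow> x s \<in> U \<and> y s \<in> U"
    unfolding eventually_at_right_field by auto
  define d where "d = min c t"
  have d: "r < d" "d \<le> t" "d \<le> c"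
    using c r' by (auto simp: d_def)
  have "x d = y d"
  proof (rule lipschitz_solutions_agree[OF _ lip])
    show "(x has_vector_derivative f (x s)) (at s)" if "s \<in> {r<..<d}" for s
      using solution_on_has_vector_derivative_at[OF x] that r' by auto
    show "(y has_vector_derivative f (y s)) (at s)" if "s \<in> {r<..<d}" for s
      using solution_on_has_vector_derivative_at[OF y] that r' by auto
  qed (use r' c d in \<open>auto intro!: cont'\<close>)
  then have "d \<in> A"
    using d r' by (auto simp: A_def)
  with max d show False by force
qed

subsection \<open>Locally Lipschitz functions and sublinear decay\<close>

text \<open>A property at a point, so that it passes through products and through
  \<open>inverse\<close> and \<open>powr\<close>, which are Lipschitz only locally. The field can
  then be treated term by term, without computing its derivative.\<close>

definition lipschitz_near :: "('a::metric_space \<Rightarrow> 'b::metric_space) \<Rightarrow> 'a \<Rightarrow> bool" where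
  "lipschitz_near f p \<longleftrightarrow> (\<exists>L U. open U \<and> p \<in> U \<and> L-lipschitz_on U f)"

lemma lipschitz_nearI: "open U \<Longrightarrow> p \<in> U \<Longrightarrow> L-lipschitz_on U f \<Longrightarrow> lipschitz_near f p"
  unfolding lipschitz_near_def by blast

lemma lipschitz_near_const: "lipschitz_near (\<lambda>_. c) p"
  by (rule lipschitz_nearI[of UNIV, OF _ _ lipschitz_on_constant]) auto

lemma lipschitz_near_ident: "lipschitz_near (\<lambda>x. x) p"
  by (rule lipschitz_nearI[of UNIV, OF _ _ lipschitz_on_id]) auto

lemma lipschitz_near_cong:
  assumes "lipschitz_near g p" "open W" "p \<in> W" "\<And>x. x \<in> W \<Longrightarrow> f x = g x"
  shows "lipschitz_near f p"
proof -
  obtain L U where "open U" "p \<in> U" "L-lipschitz_on U g"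
    using assms(1) unfolding lipschitz_near_def by blast
  then have "L-lipschitz_on (U \<inter> W) f"
    using assms(4) lipschitz_on_subset[of L U g "U \<inter> W"] by (simp add: lipschitz_on_def)
  then show ?thesis
    by (rule lipschitz_nearI[rotated 2]) (use \<open>open U\<close> \<open>p \<in> U\<close> assms(2,3) in auto)
qed

lemma lipschitz_near_compose:
  assumes "lipschitz_near f p" "lipschitz_near g (f p)"
  shows "lipschitz_near (\<lambda>x. g (f x)) p"
proof -
  obtain L U where U: "open U" "p \<in> U" "L-lipschitz_on U f"
    using assms(1) unfolding lipschitz_near_def by blast
  obtain M V where V: "open V" "f p \<in> V" "M-lipschitz_on V g"
    using assms(2) unfolding lipschitz_near_def by blast
  have "L-lipschitz_on (U \<inter> f -` V) f" "M-lipschitz_on (f ` (U \<inter> f -` V)) g"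
    using U(3) V(3) by (auto intro: lipschitz_on_subset)
  then have "(M * L)-lipschitz_on (U \<inter> f -` V) (\<lambda>x. g (f x))"
    by (rule lipschitz_on_compose2)
  moreover have "open (U \<inter> f -` V)"
    using lipschitz_on_continuous_on[OF U(3)] U(1) V(1) by (rule continuous_open_preimage)
  ultimately show ?thesis
    using U V by (intro lipschitz_nearI) auto
qed

lemma lipschitz_near_diff:
  fixes f g :: "'a::metric_space \<Rightarrow> 'b::real_normed_vector"
  assumes "lipschitz_near f p" "lipschitz_near g p"
  shows "lipschitz_near (\<lambda>x. f x - g x) p"
proof -
  obtain L U where U: "open U" "p \<in> U" "L-lipschitz_on U f"
    using assms(1) unfolding lipschitz_near_def by blast
  obtain M V where V: "open V" "p \<in> V" "M-lipschitz_on V g"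
    using assms(2) unfolding lipschitz_near_def by blast
  have "(L + M)-lipschitz_on (U \<inter> V) (\<lambda>x. f x - g x)"
    using U(3) V(3) by (intro lipschitz_on_diff) (auto intro: lipschitz_on_subset)
  then show ?thesis
    using U V by (intro lipschitz_nearI[of "U \<inter> V"]) auto
qed

text \<open>The product estimate needs bounded factors; shrinking the neighborhood supplies the
  bound.\<close>

lemma lipschitz_near_bounded:
  fixes f :: "'a::metric_space \<Rightarrow> 'b::real_normed_vector"
  assumes "lipschitz_near f p"
  obtains L U M where "open U" "p \<in> U" "L-lipschitz_on U f" "0 \<le> M" "\<And>x. x \<in> U \<Longrightarrow> norm (f x) \<le> M"
proof -
  obtain L U where U: "open U" "p \<in> U" "L-lipschitz_on U f"
    using assms unfolding lipschitz_near_def by blast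
  let ?V = "U \<inter> f -` ball 0 (norm (f p) + 1)"
  have "open ?V"
    using lipschitz_on_continuous_on[OF U(3)] U(1) by (rule continuous_open_preimage) simp
  moreover have "L-lipschitz_on ?V f"
    using U(3) by (rule lipschitz_on_subset) auto
  ultimately show ?thesis
    using U by (intro that[of ?V L "norm (f p) + 1"]) auto
qed

lemma lipschitz_near_scaleR:
  fixes f :: "'a::metric_space \<Rightarrow> 'b::real_normed_vector"
  assumes "lipschitz_near c p" "lipschitz_near f p"
  shows "lipschitz_near (\<lambda>x. c x *\<^sub>R f x) p"
proof -
  obtain L U M where U: "open U" "p \<in> U" "L-lipschitz_on U c" "0 \<le> M"
    and M: "\<And>x. x \<in> U \<Longrightarrow> norm (c x) \<le> M"
    using lipschitz_near_bounded[OF assms(1)] by metis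
  obtain L' V M' where V: "open V" "p \<in> V" "L'-lipschitz_on V f" "0 \<le> M'"
    and M': "\<And>x. x \<in> V \<Longrightarrow> norm (f x) \<le> M'"
    using lipschitz_near_bounded[OF assms(2)] by metis
  have "(M * L' + L * M')-lipschitz_on (U \<inter> V) (\<lambda>x. c x *\<^sub>R f x)"
  proof (rule lipschitz_onI)
    fix x y assume xy: "x \<in> U \<inter> V" "y \<in> U \<inter> V"
    have "dist (c x *\<^sub>R f x) (c y *\<^sub>R f y) = norm (c x *\<^sub>R (f x - f y) + (c x - c y) *\<^sub>R f y)"
      by (simp add: dist_norm algebra_simps)
    also have "\<dots> \<le> norm (c x) * norm (f x - f y) + norm (c x - c y) * norm (f y)"
      by (rule norm_triangle_le) simp
    also have "\<dots> \<le> M * (L' * dist x y) + (L * dist x y) * M'"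
    proof (intro add_mono mult_mono)
      show "norm (f x - f y) \<le> L' * dist x y"
        using lipschitz_onD[OF V(3), of x y] xy by (simp add: dist_norm)
      show "norm (c x - c y) \<le> L * dist x y"
        using lipschitz_onD[OF U(3), of x y] xy by (simp add: dist_norm)
    qed (use xy M M' U V lipschitz_on_nonneg[OF U(3)] in auto)
    finally show "dist (c x *\<^sub>R f x) (c y *\<^sub>R f y) \<le> (M * L' + L * M') * dist x y"
      by (simp add: algebra_simps)
  qed (use U V lipschitz_on_nonneg[OF U(3)] lipschitz_on_nonneg[OF V(3)] in auto)
  then show ?thesis
    using U V by (intro lipschitz_nearI[of "U \<inter> V"]) auto
qed

lemmas lipschitz_near_mult =
  lipschitz_near_scaleR[where 'b = real, unfolded real_scaleR_def]

lemma lipschitz_near_norm: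
  fixes f :: "'a::metric_space \<Rightarrow> 'b::real_normed_vector"
  assumes "lipschitz_near f p"
  shows "lipschitz_near (\<lambda>x. norm (f x)) p"
proof (rule lipschitz_near_compose[OF assms])
  have "1-lipschitz_on UNIV (norm :: 'b \<Rightarrow> real)"
    by (rule lipschitz_onI) (auto simp: dist_norm norm_triangle_ineq3)
  then show "lipschitz_near norm (f p)"
    by (intro lipschitz_nearI[of UNIV]) auto
qed

lemma lipschitz_near_C1:
  fixes g g' :: "real \<Rightarrow> real"
  assumes der: "\<And>r. 0 < r \<Longrightarrow> (g has_field_derivative g' r) (at r)"
    and cont: "continuous_on {0<..} g'" and "0 < p"
  shows "lipschitz_near g p"
proof -
  have "bounded (g' ` {p/2..2*p})"
    using \<open>0 < p\<close> by (intro compact_imp_bounded compact_continuous_image continuous_on_subset[OF cont]) auto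
  then obtain M where M: "\<And>r. r \<in> {p/2..2*p} \<Longrightarrow> norm (g' r) \<le> M"
    unfolding bounded_iff by blast
  have "0 \<le> M"
    using order_trans[OF norm_ge_zero M[of p]] \<open>0 < p\<close> by simp
  have "M-lipschitz_on {p/2<..<2*p} g"
  proof (rule lipschitz_onI)
    fix r s assume rs: "r \<in> {p/2<..<2*p}" "s \<in> {p/2<..<2*p}"
    have "norm (g r - g s) \<le> M * norm (r - s)"
    proof (rule field_differentiable_bound[OF convex_real_interval(8) _ _ rs])
      fix z assume "z \<in> {p/2<..<2*p}"
      then show "(g has_field_derivative g' z) (at z within {p/2<..<2*p})" "norm (g' z) \<le> M"
        using M \<open>0 < p\<close> by (auto intro!: DERIV_subset[OF der])
    qed
    then show "dist (g r) (g s) \<le> M * dist r s"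
      by (simp add: dist_norm)
  qed fact
  then show ?thesis
    using \<open>0 < p\<close> by (intro lipschitz_nearI[of "{p/2<..<2*p}"]) auto
qed

lemma lipschitz_near_inverse:
  fixes f :: "'a::metric_space \<Rightarrow> real"
  assumes "lipschitz_near f p" "0 < f p"
  shows "lipschitz_near (\<lambda>x. inverse (f x)) p"
  using assms(1)
proof (rule lipschitz_near_compose)
  show "lipschitz_near inverse (f p)"
    by (rule lipschitz_near_C1[where g' = "\<lambda>r. - (inverse r * inverse r)"])
      (use assms(2) in \<open>auto intro!: derivative_eq_intros continuous_intros\<close>)
qed

lemma lipschitz_near_powr:
  fixes f :: "'a::metric_space \<Rightarrow> real"
  assumes "lipschitz_near f p" "0 < f p"
  shows "lipschitz_near (\<lambda>x. f x powr a) p"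
  using assms(1)
proof (rule lipschitz_near_compose)
  show "lipschitz_near (\<lambda>r. r powr a) (f p)"
    by (rule lipschitz_near_C1[where g' = "\<lambda>r. a * r powr (a - 1)"])
      (use assms(2) in \<open>auto intro!: has_real_derivative_powr continuous_intros\<close>)
qed

text \<open>\<open>w powr (1 - \<beta>)\<close> decreases at least at the constant rate
  \<open>(1 - \<beta>) * \<kappa>\<close> and cannot become negative. For positive \<kappa> a
  function with this decay can therefore stay positive only for a bounded time.\<close>

lemma sublinear_decay_bound:
  fixes w :: "real \<Rightarrow> real"
  assumes "0 \<le> T" "\<beta> < 1" "continuous_on {0..T} w"
    and pos: "\<And>t. t \<in> {0..T} \<Longrightarrow> 0 < w t"
    and der: "\<And>t. t \<in> {0<..<T} \<Longrightarrow> (w has_field_derivative w' t) (at t) \<and> w' t \<le> - \<kappa> * w t powr \<beta>"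
  shows "(1 - \<beta>) * \<kappa> * T \<le> w 0 powr (1 - \<beta>)"
proof -
  define u where "u t = w t powr (1 - \<beta>) + (1 - \<beta>) * \<kappa> * t" for t
  have "u T \<le> u 0"
  proof (rule DERIV_nonpos_imp_decreasing_open[OF \<open>0 \<le> T\<close>])
    show "continuous_on {0..T} u"
      unfolding u_def using pos assms(3) by (intro continuous_intros) (auto simp: less_imp_neq[symmetric])
    fix t assume t: "0 < t" "t < T"
    then have w: "0 < w t" and w': "(w has_field_derivative w' t) (at t)" "w' t \<le> - \<kappa> * w t powr \<beta>"
      using pos der by auto
    have "((\<lambda>t. w t powr (1 - \<beta>)) has_field_derivative (1 - \<beta>) * w t powr (- \<beta>) * w' t) (at t)"
      using DERIV_chain2[OF has_real_derivative_powr[OF w, of "1 - \<beta>"] w'(1)] by simp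
    moreover have "((\<lambda>t. (1 - \<beta>) * \<kappa> * t) has_field_derivative (1 - \<beta>) * \<kappa>) (at t)"
      by (auto intro!: derivative_eq_intros)
    ultimately have "(u has_field_derivative (1 - \<beta>) * w t powr (- \<beta>) * w' t + (1 - \<beta>) * \<kappa>) (at t)"
      unfolding u_def by (rule DERIV_add)
    moreover have "w t powr (- \<beta>) * w' t \<le> w t powr (- \<beta>) * (- \<kappa> * w t powr \<beta>)"
      using w'(2) by (intro mult_left_mono) auto
    then have "w t powr (- \<beta>) * w' t \<le> - \<kappa>"
      using w by (simp add: powr_minus field_simps)
    then have "(1 - \<beta>) * (w t powr (- \<beta>) * w' t) \<le> (1 - \<beta>) * (- \<kappa>)"
      using \<open>\<beta> < 1\<close> by (intro mult_left_mono) auto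
    ultimately show "\<exists>d. DERIV u t :> d \<and> d \<le> 0"
      by (intro exI conjI) (auto simp: algebra_simps)
  qed
  then have "(1 - \<beta>) * \<kappa> * T + w T powr (1 - \<beta>) \<le> w 0 powr (1 - \<beta>)"
    by (simp add: u_def)
  then show ?thesis
    using powr_ge_zero[of "w T" "1 - \<beta>"] by linarith
qed

subsection \<open>The closed loop\<close>

text \<open>Of the two bounds on \<epsilon>, the first makes \<open>1 / \<epsilon>\<close> at most
  1, so that estimates of the denominator do not involve \<epsilon>. The second puts the level
  \<open>dc / 2\<close>, used near the goal, below \<open>dc\<^sup>2 * \<epsilon>\<close>, which
  bounds \<open>B\<close> from below on the obstacle boundary.\<close>

locale barrier_closed_loop =
  fixes \<tau> obs :: "'a::euclidean_space" and dc \<epsilon> k1 \<alpha> :: real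
  assumes dc_pos: "0 < dc" and far: "2 * dc < norm (obs - \<tau>)" and k1_pos: "0 < k1"
    and \<alpha>_pos: "0 < \<alpha>" and \<alpha>_less_1: "\<alpha> < 1"
    and \<epsilon>_ge_1: "1 \<le> \<epsilon>" and dc_\<epsilon>: "1 \<le> dc * \<epsilon>"
begin

abbreviation "B \<equiv> barrier \<tau> obs dc \<epsilon>"
abbreviation "f \<equiv> control_law k1 \<alpha> \<tau> obs dc \<epsilon>"
abbreviation "D \<equiv> closed_loop_domain obs dc \<epsilon>"
abbreviation "den x \<equiv> norm (x - obs) - dc + 1 / \<epsilon>"

text \<open>The gradient of \<open>B\<close> on \<open>D\<close>, from the quotient rule.\<close>

definition G :: "'a \<Rightarrow> 'a" where
  "G x = (2 / den x) *\<^sub>R (x - \<tau>) - ((norm (x - \<tau>) / den x)\<^sup>2 / norm (x - obs)) *\<^sub>R (x - obs)"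

text \<open>The feedback as a function of the gradient. It is 0 at \<open>v = 0\<close>, so the case
  distinction in \<open>control_law\<close> disappears.\<close>

definition \<phi> :: "'a \<Rightarrow> 'a" where
  "\<phi> v = - (k1 * norm v powr (\<alpha> - 1)) *\<^sub>R v"

lemma \<epsilon>_inverse: "0 < 1 / \<epsilon>" "1 / \<epsilon> \<le> 1"
  using \<epsilon>_ge_1 by auto

lemma den_pos: "dc \<le> norm (x - obs) \<Longrightarrow> 0 < den x"
  using \<epsilon>_inverse by linarith

lemma in_D: "dc \<le> norm (x - obs) \<Longrightarrow> x \<in> D"
  using den_pos[of x] dc_pos by (auto simp: closed_loop_domain_def)

lemma D_eq: "D = - {obs} \<inter> {x. den x \<noteq> 0}"
  by (auto simp: closed_loop_domain_def)

lemma open_D: "open D"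
  unfolding D_eq by (intro open_Int open_Collect_neq continuous_intros)

lemma B_GDERIV:
  assumes "x \<in> D"
  shows "GDERIV B x :> G x"
proof -
  have ne: "x \<noteq> obs" "den x \<noteq> 0"
    using assms by (auto simp: closed_loop_domain_def)
  have 1: "((\<lambda>x. norm (x - obs)) has_derivative (\<lambda>h. h \<bullet> sgn (x - obs))) (at x)"
  proof -
    have "((\<lambda>x. x - obs) has_derivative (\<lambda>h. h)) (at x)"
      by (auto intro!: derivative_eq_intros)
    then show ?thesis
      using has_derivative_compose[OF _ has_derivative_norm, of "\<lambda>x. x - obs" "\<lambda>h. h" x UNIV] ne(1)
      by simp
  qed
  have 2: "((\<lambda>x. (norm (x - \<tau>))\<^sup>2) has_derivative (\<lambda>h. 2 * (h \<bullet> (x - \<tau>)))) (at x)"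
    unfolding power2_norm_eq_inner
    by (auto intro!: derivative_eq_intros simp: inner_commute)
  have "(B has_derivative (\<lambda>h. (2 * (h \<bullet> (x - \<tau>)) * den x - (norm (x - \<tau>))\<^sup>2 * (h \<bullet> sgn (x - obs)))
      / (den x * den x))) (at x)"
    unfolding barrier_def[abs_def]
    by (rule has_derivative_divide'[OF 2, THEN has_derivative_eq_rhs])
      (use ne in \<open>auto intro!: derivative_eq_intros 1\<close>)
  moreover have "(2 * (h \<bullet> (x - \<tau>)) * den x - (norm (x - \<tau>))\<^sup>2 * (h \<bullet> sgn (x - obs)))
      / (den x * den x) = h \<bullet> G x" for h
  proof -
    have "h \<bullet> G x = 2 / den x * (h \<bullet> (x - \<tau>))
        - (norm (x - \<tau>) / den x)\<^sup>2 * (h \<bullet> sgn (x - obs))"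
      by (simp only: G_def inner_diff_right inner_scaleR_right sgn_div_norm divide_inverse mult.assoc)
    then show ?thesis
      using ne(2) by (simp add: power_divide diff_divide_distrib power2_eq_square)
  qed
  ultimately show ?thesis
    by (simp add: gderiv_def)
qed

lemma f_eq: "x \<in> D \<Longrightarrow> f x = \<phi> (G x)"
  by (simp add: control_law_def \<phi>_def gradient_eqI[OF B_GDERIV] Let_def)

lemma continuous_on_G: "continuous_on D G"
  unfolding G_def[abs_def] by (intro continuous_intros) (auto simp: closed_loop_domain_def)

lemma continuous_on_B: "continuous_on D B"
  unfolding barrier_def[abs_def] by (intro continuous_intros) (auto simp: closed_loop_domain_def)

text \<open>Only the origin is delicate: the negative power is unbounded there, but
  \<open>\<phi> v\<close> has length \<open>k1 * norm v powr \<alpha>\<close> with a positive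
  exponent.\<close>

lemma continuous_on_\<phi>: "continuous_on UNIV \<phi>"
proof -
  have "isCont \<phi> v" if "v \<noteq> 0" for v
    unfolding \<phi>_def[abs_def] using that by (intro continuous_intros) auto
  moreover have "isCont \<phi> 0"
  proof -
    have "((\<lambda>v::'a. k1 * norm v powr \<alpha>) \<longlongrightarrow> k1 * 0 powr \<alpha>) (at 0)"
      using \<alpha>_pos by (intro tendsto_mult tendsto_powr' tendsto_norm_zero tendsto_intros) auto
    then have "(\<phi> \<longlongrightarrow> 0) (at 0)"
    proof (rule Lim_null_comparison[rotated, OF tendsto_eq_rhs])
      show "\<forall>\<^sub>F v in at 0. norm (\<phi> v) \<le> k1 * norm v powr \<alpha>"
      proof (intro always_eventually allI)
        fix v :: 'a
        show "norm (\<phi> v) \<le> k1 * norm v powr \<alpha>"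
          using k1_pos by (cases "v = 0") (auto simp: \<phi>_def powr_diff)
      qed
    qed simp
    then show ?thesis
      by (simp add: isCont_def \<phi>_def)
  qed
  ultimately show ?thesis
    by (metis continuous_at_imp_continuous_on)
qed

lemma continuous_on_f: "continuous_on D f"
proof -
  have "continuous_on D (\<lambda>x. \<phi> (G x))"
    by (rule continuous_on_compose2[OF continuous_on_\<phi> continuous_on_G]) auto
  then show ?thesis
    by (simp add: f_eq cong: continuous_on_cong)
qed

lemma lipschitz_near_f:
  assumes "dc \<le> norm (p - obs)" "G p \<noteq> 0"
  shows "lipschitz_near f p"
proof -
  have pos: "0 < den p" "0 < norm (p - obs)"
    using den_pos[OF assms(1)] assms(1) dc_pos by auto
  have nn: "lipschitz_near (\<lambda>x. norm (x - obs)) p" "lipschitz_near (\<lambda>x. norm (x - \<tau>)) p"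
    by (intro lipschitz_near_norm lipschitz_near_diff lipschitz_near_ident lipschitz_near_const)+
  have "lipschitz_near (\<lambda>x. norm (x - obs) - (dc - 1 / \<epsilon>)) p"
    by (intro lipschitz_near_diff nn lipschitz_near_const)
  then have den: "lipschitz_near den p"
    by (simp add: algebra_simps)
  have G: "lipschitz_near G p"
    unfolding G_def[abs_def] divide_inverse power2_eq_square
    by (intro lipschitz_near_diff lipschitz_near_scaleR lipschitz_near_mult lipschitz_near_inverse
        lipschitz_near_ident lipschitz_near_const nn den[unfolded divide_inverse]
        pos[unfolded divide_inverse])
  \<comment> \<open>The minus sign is written as a difference from 0 to fit the closure rules.
    \<open>G p \<noteq> 0\<close> is what keeps \<open>powr\<close> away from its
    singularity.\<close>
  have "lipschitz_near (\<lambda>x. (0 - k1 * norm (G x) powr (\<alpha> - 1)) *\<^sub>R G x) p"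
    using assms(2) by (intro lipschitz_near_scaleR lipschitz_near_diff lipschitz_near_mult
        lipschitz_near_powr lipschitz_near_norm lipschitz_near_const G) auto
  then show ?thesis
    by (rule lipschitz_near_cong[OF _ open_D in_D[OF assms(1)]]) (simp add: f_eq \<phi>_def)
qed

section \<open>Decrease of the barrier and trapping in the safe region\<close>

lemma B_derivative:
  assumes "x t \<in> D" "(x has_vector_derivative f (x t)) (at t)"
  shows "((\<lambda>t. B (x t)) has_field_derivative - k1 * norm (G (x t)) powr (\<alpha> + 1)) (at t)"
proof -
  have chain: "((\<lambda>t. B (x t)) has_derivative (\<lambda>h. (h *\<^sub>R f (x t)) \<bullet> G (x t))) (at t)"
    using has_derivative_compose[OF assms(2)[unfolded has_vector_derivative_def]
        B_GDERIV[OF assms(1), unfolded gderiv_def]] .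
  have eq: "(h *\<^sub>R f (x t)) \<bullet> G (x t) = (- k1 * norm (G (x t)) powr (\<alpha> + 1)) * h" for h
  proof -
    \<comment> \<open>At a zero of the gradient both sides vanish, because
      \<open>0 powr a = 0\<close>.\<close>
    have "norm (G (x t)) powr (\<alpha> + 1) = norm (G (x t)) powr (\<alpha> - 1) * (G (x t) \<bullet> G (x t))"
      using powr_add[of "norm (G (x t))" "\<alpha> - 1" 2]
      by (cases "G (x t) = 0") (auto simp: power2_norm_eq_inner[symmetric] add.commute)
    then show ?thesis
      by (simp add: f_eq[OF assms(1)] \<phi>_def)
  qed
  show ?thesis
    unfolding has_field_derivative_def
    by (rule has_derivative_eq_rhs[OF chain]) (rule ext, rule eq)
qed

lemma B_decreasing:
  assumes "s \<le> t" and cont: "continuous_on {s..t} x" and D: "\<And>r. r \<in> {s..t} \<Longrightarrow> x r \<in> D"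
    and der: "\<And>r. r \<in> {s<..<t} \<Longrightarrow> (x has_vector_derivative f (x r)) (at r)"
  shows "B (x t) \<le> B (x s)"
proof (rule DERIV_nonpos_imp_decreasing_open[OF \<open>s \<le> t\<close>, of "\<lambda>t. B (x t)"])
  show "continuous_on {s..t} (\<lambda>t. B (x t))"
    by (rule continuous_on_compose2[OF continuous_on_B cont]) (use D in auto)
  fix r assume "s < r" "r < t"
  then have "((\<lambda>t. B (x t)) has_field_derivative - k1 * norm (G (x r)) powr (\<alpha> + 1)) (at r)"
    by (intro B_derivative D der) auto
  then show "\<exists>d. ((\<lambda>t. B (x t)) has_field_derivative d) (at r) \<and> d \<le> 0"
    using k1_pos by (intro exI conjI) auto
qed

text \<open>A radius that safe points with \<open>B x \<le> c\<close> cannot reach. For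
  \<open>r = norm (x - \<tau>)\<close> and \<open>a = norm (obs - \<tau>)\<close> they satisfy
  \<open>r^2 \<le> c * (r + a + 1)\<close>, which fails once
  \<open>r \<ge> c + a + 2\<close>.\<close>

definition R :: "real \<Rightarrow> real" where
  "R c = c + norm (obs - \<tau>) + 2"

definition K :: "real \<Rightarrow> 'a set" where
  "K c = {x. dc \<le> norm (x - obs) \<and> norm (x - \<tau>) \<le> R c}"

text \<open>The strict counterpart of \<open>K c\<close>: limits of points of \<open>W c\<close> are
  only known to lie in \<open>K c\<close>, and a bound on \<open>B\<close> brings them back.\<close>

definition W :: "real \<Rightarrow> 'a set" where
  "W c = {x. dc < norm (x - obs) \<and> norm (x - \<tau>) < R c}"

text \<open>On the obstacle boundary the denominator is \<open>1 / \<epsilon>\<close> and the goal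
  is farther away than \<open>dc\<close>, so \<open>B\<close> exceeds
  \<open>dc\<^sup>2 * \<epsilon>\<close> there.\<close>

definition S :: "'a set" where
  "S = {x. dc < norm (x - obs) \<and> B x < dc\<^sup>2 * \<epsilon>}"

lemma W_subset_K: "W c \<subseteq> K c"
  by (auto simp: W_def K_def)

lemma K_subset_D: "K c \<subseteq> D"
  by (auto simp: K_def in_D)

lemma open_W: "open (W c)"
proof -
  have "W c = {x. dc < norm (x - obs)} \<inter> {x. norm (x - \<tau>) < R c}"
    by (auto simp: W_def)
  then show ?thesis
    by (simp add: open_Int open_Collect_less continuous_intros)
qed

lemma closed_K: "closed (K c)"
proof -
  have "K c = {x. dc \<le> norm (x - obs)} \<inter> {x. norm (x - \<tau>) \<le> R c}"
    by (auto simp: K_def)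
  then show ?thesis
    by (simp add: closed_Int closed_Collect_le continuous_intros)
qed

lemma compact_K: "compact (K c)"
proof -
  have "K c \<subseteq> cball \<tau> (R c)"
    by (auto simp: K_def dist_norm norm_minus_commute)
  then show ?thesis
    using closed_K bounded_subset[OF bounded_cball] by (auto simp: compact_eq_bounded_closed)
qed

lemma B_nonneg: "dc \<le> norm (x - obs) \<Longrightarrow> 0 \<le> B x"
  using den_pos[of x] by (simp add: barrier_def)

lemma norm_sq_eq_B: "dc \<le> norm (x - obs) \<Longrightarrow> (norm (x - \<tau>))\<^sup>2 = B x * den x"
  using den_pos[of x] by (simp add: barrier_def)

lemma den_le: "den x \<le> norm (x - \<tau>) + norm (obs - \<tau>) + 1"
  using norm_triangle_ineq[of "x - \<tau>" "\<tau> - obs"] \<epsilon>_inverse(2) dc_pos norm_minus_commute[of \<tau> obs]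
  by simp

lemma norm_goal_le: "norm (obs - \<tau>) \<le> norm (x - obs) + norm (x - \<tau>)"
  using norm_triangle_ineq[of "obs - x" "x - \<tau>"] by (simp add: norm_minus_commute)

text \<open>The gain from weak to strict inequalities is what closes the trap: a bound on
  \<open>B\<close> excludes both the obstacle boundary and the sphere of radius
  \<open>R c\<close>.\<close>

lemma sublevel_subset_W:
  assumes "dc \<le> norm (x - obs)" "B x \<le> c" "c < dc\<^sup>2 * \<epsilon>"
  shows "x \<in> W c"
proof -
  define r where "r = norm (x - \<tau>)"
  have r0: "0 \<le> r" by (simp add: r_def)
  have c0: "0 \<le> c"
    using B_nonneg[OF assms(1)] assms(2) by simp
  have r2: "r\<^sup>2 \<le> c * den x"
    using norm_sq_eq_B[OF assms(1)] mult_right_mono[OF assms(2), of "den x"] den_pos[OF assms(1)]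
    by (simp add: r_def)
  have "norm (x - obs) \<noteq> dc"
  proof
    assume eq: "norm (x - obs) = dc"
    then have "dc < r"
      using norm_goal_le[of x] far by (simp add: r_def)
    then have "dc\<^sup>2 < r\<^sup>2"
      using dc_pos by (intro power_strict_mono) auto
    also have "\<dots> \<le> c / \<epsilon>"
      using r2 eq by simp
    also have "\<dots> < dc\<^sup>2"
      using assms(3) \<epsilon>_ge_1 by (simp add: field_simps)
    finally show False .
  qed
  moreover have "r < R c"
  proof (rule ccontr)
    assume "\<not> r < R c"
    then have r: "R c \<le> r" by simp
    let ?a = "norm (obs - \<tau>)"
    have "c < r" "0 < r"
      using r c0 norm_ge_zero[of "obs - \<tau>"] unfolding R_def by linarith+
    have "r * R c \<le> r * r"
      using r r0 by (intro mult_left_mono)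
    also have "\<dots> \<le> c * den x"
      using r2 by (simp add: power2_eq_square)
    also have "\<dots> \<le> c * (r + ?a + 1)"
      using den_le[of x] c0 unfolding r_def by (intro mult_left_mono)
    finally have "r * (?a + 2) \<le> c * (?a + 1)"
      by (simp add: R_def algebra_simps)
    also have "\<dots> \<le> r * (?a + 1)"
      using \<open>c < r\<close> by (intro mult_right_mono) auto
    finally show False
      using \<open>0 < r\<close> by (simp add: algebra_simps)
  qed
  ultimately show ?thesis
    using assms(1) by (simp add: W_def r_def)
qed

text \<open>Consider the first exit from the open set \<open>W c\<close>. Up to and including that
  time the curve lies in \<open>K c\<close>, so \<open>B\<close> has not increased and the exit
  point is in \<open>W c\<close> after all. The differential equation is assumed only inside
  \<open>K c\<close>, because the lemma also serves curves driven by a field that agrees with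
  \<open>f\<close> only there.\<close>

lemma invariant:
  assumes p: "dc < norm (x t0 - obs)" "B (x t0) \<le> c" "c < dc\<^sup>2 * \<epsilon>"
    and "t0 \<le> T" and cont: "continuous_on {t0..T} x"
    and der: "\<And>t. t \<in> {t0<..<T} \<Longrightarrow> x t \<in> K c \<Longrightarrow> (x has_vector_derivative f (x t)) (at t)"
  shows "x T \<in> W c" "B (x T) \<le> B (x t0)"
proof -
  have "x t \<in> W c" if "t \<in> {t0..T}" for t
  proof (rule ccontr)
    assume "x t \<notin> W c"
    define A where "A = {t0..T} \<inter> x -` (- W c)"
    have "closed A"
      unfolding A_def by (intro continuous_closed_preimage cont) (auto simp: open_W closed_Compl)
    then have "compact A"
      using compact_Icc[of t0 T] by (simp add: A_def compact_eq_bounded_closed bounded_Int)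
    moreover have "A \<noteq> {}"
      using that \<open>x t \<notin> W c\<close> by (auto simp: A_def)
    ultimately obtain s where s: "s \<in> A" and min: "\<And>r. r \<in> A \<Longrightarrow> s \<le> r"
      using compact_attains_inf[of A] by auto
    have "x t0 \<in> W c"
      using p by (intro sublevel_subset_W) auto
    then have "t0 < s" "s \<le> T"
      using s by (auto simp: A_def order.order_iff_strict)
    have before: "x r \<in> W c" if "r \<in> {t0..<s}" for r
      using min[of r] that \<open>s \<le> T\<close> by (force simp: A_def)
    have cont_s: "continuous_on {t0..s} x"
      using cont \<open>s \<le> T\<close> by (auto intro: continuous_on_subset)
    then have "x ` closure {t0..<s} \<subseteq> K c"
      using before closed_K \<open>t0 < s\<close>
      by (intro image_closure_subset) (auto intro: subsetD[OF W_subset_K])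
    then have K: "x r \<in> K c" if "r \<in> {t0..s}" for r
      using that \<open>t0 < s\<close> by auto
    have "B (x s) \<le> B (x t0)"
      using \<open>t0 < s\<close> \<open>s \<le> T\<close> K K_subset_D by (intro B_decreasing cont_s der) auto
    then have "x s \<in> W c"
      using p K[of s] \<open>t0 < s\<close> by (intro sublevel_subset_W) (auto simp: K_def)
    with s show False
      by (simp add: A_def)
  qed
  then have "x t \<in> W c" "x t \<in> K c" "x t \<in> D" if "t \<in> {t0..T}" for t
    using that W_subset_K K_subset_D by blast+
  then show "x T \<in> W c" "B (x T) \<le> B (x t0)"
    using \<open>t0 \<le> T\<close> by (auto intro!: B_decreasing cont der)
qed

section \<open>Safety and global existence of closed-loop solutions\<close>

lemma solution_stays:
  assumes sol: "solution_on f D t0 p b x" and "p \<in> S" and t: "t \<in> right_interval t0 b"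
  shows "x t \<in> W (B p)" "B (x t) \<le> B p"
proof -
  have "x t0 = p"
    using sol by (simp add: solution_on_def)
  have sub: "{t0..t} \<subseteq> right_interval t0 b"
    using t by (auto simp: right_interval_def intro: le_less_trans[of _ "ereal t"])
  have "dc < norm (x t0 - obs)" "B (x t0) \<le> B p" "B p < dc\<^sup>2 * \<epsilon>" "t0 \<le> t" "continuous_on {t0..t} x"
    using \<open>p \<in> S\<close> \<open>x t0 = p\<close> t solution_on_continuous_on[OF sol] sub
    by (auto simp: S_def right_interval_def intro: continuous_on_subset)
  moreover have "(x has_vector_derivative f (x s)) (at s)" if "s \<in> {t0<..<t}" for s
    using that t by (intro solution_on_has_vector_derivative_at[OF sol])
      (auto simp: right_interval_def intro: less_trans[of _ "ereal t"])
  ultimately show "x t \<in> W (B p)" "B (x t) \<le> B p"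
    using invariant[of x t0 "B p" t] \<open>x t0 = p\<close> by auto
qed

lemma solution_B_decreasing:
  assumes sol: "solution_on f D t0 p \<infinity> x" and "t0 \<le> s" "s \<le> t"
  shows "B (x t) \<le> B (x s)"
  using assms solution_on_continuous_on[OF sol]
  by (intro B_decreasing solution_on_has_vector_derivative_at[OF sol])
    (auto simp: solution_on_def intro: continuous_on_subset)

text \<open>Tietze's theorem extends the field from the compact set to a bounded continuous field on
  the whole space, to which Peano's theorem applies. By \<open>invariant\<close> the solution never
  leaves the region where the two fields agree. As the field is autonomous, the start can be shifted
  to \<open>t0\<close>.\<close>

lemma global_solution:
  assumes "p \<in> S"
  obtains x where "solution_on f D t0 p \<infinity> x"
proof -
  let ?K = "K (B p)"
  have contf: "continuous_on ?K f"
    by (rule continuous_on_subset[OF continuous_on_f K_subset_D])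
  have "bounded (f ` ?K)"
    by (intro compact_imp_bounded compact_continuous_image contf compact_K)
  then obtain M where "0 < M" and M: "\<And>x. x \<in> ?K \<Longrightarrow> norm (f x) \<le> M"
    unfolding bounded_pos by blast
  have "closedin (top_of_set UNIV) ?K"
    using closed_K by simp
  with contf obtain F where F: "continuous_on UNIV F" "\<And>x. x \<in> ?K \<Longrightarrow> F x = f x"
    "\<And>x. norm (F x) \<le> M"
    using Tietze[of ?K f UNIV M] M \<open>0 < M\<close> by (metis UNIV_I less_imp_le)
  obtain z where z: "z 0 = p" "\<And>t. 0 \<le> t \<Longrightarrow> (z has_vector_derivative F (z t)) (at t within {0..})"
    using Peano_bounded_continuous[OF F(1,3)] by metis
  have contz: "continuous_on {0..} z"
    using z(2) by (auto simp: continuous_on_eq_continuous_within intro: has_vector_derivative_continuous)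
  have derz: "(z has_vector_derivative F (z t)) (at t)" if "0 < t" for t
  proof -
    have "(z has_vector_derivative F (z t)) (at t within {0<..})"
      using z(2)[of t] that by (auto intro: has_vector_derivative_within_subset)
    then show ?thesis
      using that by (simp add: at_within_open[of t "{0<..}"])
  qed
  have W: "z t \<in> W (B p)" if "0 \<le> t" for t
  proof (rule invariant)
    show "continuous_on {0..t} z"
      by (rule continuous_on_subset[OF contz]) auto
    show "(z has_vector_derivative f (z s)) (at s)" if "s \<in> {0<..<t}" "z s \<in> ?K" for s
      using derz[of s] F(2) that by auto
  qed (use that \<open>p \<in> S\<close> z in \<open>auto simp: S_def\<close>)
  have "solution_on f D t0 p \<infinity> (\<lambda>t. z (t - t0))"
  proof (rule solution_on_infinityI[OF _ _ _ continuous_on_f])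
    show "continuous_on {t0..} (\<lambda>t. z (t - t0))"
      by (rule continuous_on_compose2[OF contz]) (auto intro!: continuous_intros)
    show "z (t - t0) \<in> D" if "t0 \<le> t" for t
      using W[of "t - t0"] that W_subset_K K_subset_D by auto
    fix t assume "t0 < t"
    have "((\<lambda>t. t - t0) has_vector_derivative 1) (at t)"
      by (auto intro!: derivative_eq_intros)
    from vector_diff_chain_at[OF this derz[of "t - t0"]]
    have "((\<lambda>t. z (t - t0)) has_vector_derivative F (z (t - t0))) (at t)"
      using \<open>t0 < t\<close> by (simp add: o_def)
    moreover have "z (t - t0) \<in> ?K"
      using W[of "t - t0"] \<open>t0 < t\<close> W_subset_K by auto
    ultimately show "((\<lambda>t. z (t - t0)) has_vector_derivative f (z (t - t0))) (at t)"
      using F(2) by simp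
  qed (simp add: z)
  then show ?thesis
    by (rule that)
qed

lemma right_maximal_solution_infinity:
  assumes "solution_on f D t0 p \<infinity> x"
  shows "right_maximal_solution f D t0 p \<infinity> x"
  using assms by (auto simp: right_maximal_solution_def)

lemma right_maximal_solution_global:
  assumes max: "right_maximal_solution f D t0 p b x" and "p \<in> S"
  shows "b = \<infinity>"
proof (cases b)
  case (real r)
  \<comment> \<open>\<open>K (B p)\<close> alone may contain boundary points or points with a large
    barrier. With the bound on \<open>B\<close>, each of its points lies in \<open>S\<close> and can
    serve as a new start.\<close>
  let ?K = "{q \<in> K (B p). B q \<le> B p}"
  have sol: "solution_on f D t0 p (ereal r) x"
    using max real by (simp add: right_maximal_solution_def)
  have "compact ?K"
  proof -
    have "?K = K (B p) \<inter> B -` {..B p}"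
      by auto
    moreover have "closed (K (B p) \<inter> B -` {..B p})"
      by (intro continuous_closed_preimage closed_K closed_atMost
          continuous_on_subset[OF continuous_on_B K_subset_D])
    ultimately show ?thesis
      using compact_K[of "B p"] by (simp add: compact_eq_bounded_closed bounded_Int)
  qed
  moreover have "\<exists>z. solution_on f D r q \<infinity> z" if "q \<in> ?K" for q
  proof -
    have "q \<in> W (B p)"
      using that \<open>p \<in> S\<close> by (intro sublevel_subset_W) (auto simp: K_def S_def)
    then have "q \<in> S"
      using that \<open>p \<in> S\<close> by (auto simp: W_def S_def)
    then show ?thesis
      using global_solution by metis
  qed
  moreover have "x t \<in> ?K" if "t \<in> {t0..<r}" for t
    using solution_stays[OF sol \<open>p \<in> S\<close>] that W_subset_K by auto
  ultimately have "\<exists>y. solution_on f D t0 p \<infinity> y \<and> (\<forall>t\<in>{t0..<r}. y t = x t)"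
    using K_subset_D by (intro solution_on_extend_infinity[OF sol _ _ _ continuous_on_f, of ?K]) auto
  then have "\<exists>b' y. b < b' \<and> solution_on f D t0 p b' y \<and> (\<forall>t\<in>right_interval t0 b. y t = x t)"
    using real by (intro exI[of _ \<infinity>]) simp
  then show ?thesis
    using max by (simp add: right_maximal_solution_def)
next
  case PInf
  then show ?thesis by simp
next
  case MInf
  then show ?thesis
    using max by (simp add: right_maximal_solution_def solution_on_def)
qed

subsection \<open>Behaviour near the goal\<close>

text \<open>A sublevel set instead of a ball, since sublevel sets are invariant. The level comes
  from \<open>N_den\<close>.\<close>

definition N :: "'a set" where
  "N = {x. dc < norm (x - obs) \<and> B x < dc / 2}"

lemma N_subset_S: "N \<subseteq> S"
proof -
  have "dc / 2 < dc\<^sup>2 * \<epsilon>"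
    using mult_left_mono[OF dc_\<epsilon>, of dc] dc_pos by (simp add: power2_eq_square mult.assoc)
  then show ?thesis
    by (auto simp: N_def S_def)
qed

lemma goal_clear: "dc < norm (\<tau> - obs)"
  using far dc_pos by (simp add: norm_minus_commute)

lemma B_goal [simp]: "B \<tau> = 0"
  by (simp add: barrier_def)

lemma B_eq_0_iff: "dc \<le> norm (x - obs) \<Longrightarrow> B x = 0 \<longleftrightarrow> x = \<tau>"
  using den_pos[of x] by (simp add: barrier_def)

lemma goal_in_N: "\<tau> \<in> N"
  using goal_clear dc_pos by (simp add: N_def)

lemma f_goal: "f \<tau> = 0"
  using in_D[of \<tau>] goal_clear by (simp add: f_eq \<phi>_def G_def)

lemma open_sublevel: "open {x. dc < norm (x - obs) \<and> B x < c}"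
proof -
  let ?A = "{x. dc < norm (x - obs)}"
  have "open ?A"
    by (intro open_Collect_less continuous_intros)
  moreover have "continuous_on ?A B"
    by (rule continuous_on_subset[OF continuous_on_B]) (auto intro: in_D)
  ultimately have "open (?A \<inter> B -` {..<c})"
    by (intro continuous_open_preimage) auto
  moreover have "?A \<inter> B -` {..<c} = {x. dc < norm (x - obs) \<and> B x < c}"
    by auto
  ultimately show ?thesis by simp
qed

lemma open_N: "open N"
  unfolding N_def by (rule open_sublevel)

text \<open>If \<open>den x < norm (x - \<tau>)\<close>, then
  \<open>norm (x - \<tau>) < B x\<close>. Also \<open>norm (x - obs)\<close> is less than
  \<open>norm (x - \<tau>) + dc\<close>, so the triangle inequality and \<open>far\<close> give
  \<open>norm (x - \<tau>) > dc / 2\<close>. The level \<open>dc / 2\<close> in \<open>N\<close>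
  excludes having both.\<close>

lemma N_den: "x \<in> N \<Longrightarrow> norm (x - \<tau>) \<le> den x"
proof (rule ccontr)
  assume x: "x \<in> N" and "\<not> norm (x - \<tau>) \<le> den x"
  then have less: "den x < norm (x - \<tau>)" and pos: "0 < den x" and "B x < dc / 2"
    using den_pos[of x] by (auto simp: N_def)
  have "norm (x - \<tau>) * den x < norm (x - \<tau>) * norm (x - \<tau>)"
    using less pos by (intro mult_strict_left_mono) auto
  also have "\<dots> = B x * den x"
    using norm_sq_eq_B[of x] x by (simp add: N_def power2_eq_square)
  finally have "norm (x - \<tau>) < B x"
    using pos by simp
  moreover have "dc < 2 * norm (x - \<tau>)"
    using norm_goal_le[of x] far less \<epsilon>_inverse(1) by linarith
  ultimately show False
    using \<open>B x < dc / 2\<close> by simp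
qed

lemma norm_G_ge:
  assumes "x \<in> N"
  shows "norm (x - \<tau>) / den x \<le> norm (G x)"
proof -
  have pos: "0 < den x" "0 < norm (x - obs)"
    using assms den_pos[of x] dc_pos by (auto simp: N_def intro: less_trans)
  let ?q = "norm (x - \<tau>) / den x"
  have q: "0 \<le> ?q" "?q \<le> 1"
    using N_den[OF assms] pos by auto
  have "norm ((2 / den x) *\<^sub>R (x - \<tau>)) - norm ((?q\<^sup>2 / norm (x - obs)) *\<^sub>R (x - obs)) \<le> norm (G x)"
    unfolding G_def by (rule norm_triangle_ineq2)
  moreover have "norm ((2 / den x) *\<^sub>R (x - \<tau>)) = 2 * ?q"
    using pos(1) by simp
  moreover have "norm ((?q\<^sup>2 / norm (x - obs)) *\<^sub>R (x - obs)) = ?q\<^sup>2"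
    using pos(2) by simp
  moreover have "?q\<^sup>2 \<le> ?q"
    using mult_left_mono[OF q(2) q(1)] by (simp add: power2_eq_square)
  ultimately show ?thesis by linarith
qed

lemma G_nonzero: "x \<in> N \<Longrightarrow> x \<noteq> \<tau> \<Longrightarrow> G x \<noteq> 0"
proof -
  assume x: "x \<in> N" "x \<noteq> \<tau>"
  then have "0 < norm (x - \<tau>) / den x"
    using den_pos[of x] by (intro divide_pos_pos) (auto simp: N_def)
  with norm_G_ge[OF x(1)] show ?thesis by auto
qed

section \<open>Uniqueness near the goal\<close>

lemma solution_in_N:
  assumes sol: "solution_on f D t0 p \<infinity> x" and "p \<in> N" "t0 \<le> t"
  shows "x t \<in> N"
  using solution_stays[OF sol, of t] assms N_subset_S by (auto simp: N_def W_def)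

text \<open>Along the solution \<open>B\<close> is nonnegative and nonincreasing, and among safe
  points it vanishes only at the goal. This settles the case in which the field need not be
  Lipschitz.\<close>

lemma solution_absorbed:
  assumes sol: "solution_on f D t0 p \<infinity> x" and p: "p \<in> N" and "t0 \<le> s" "x s = \<tau>" "s \<le> t"
  shows "x t = \<tau>"
proof -
  have "x t \<in> N"
    using solution_in_N[OF sol p] assms by simp
  then have t: "dc \<le> norm (x t - obs)"
    by (simp add: N_def)
  have "B (x t) \<le> 0"
    using solution_B_decreasing[OF sol, of s t] assms by simp
  with B_nonneg[OF t] show ?thesis
    using B_eq_0_iff[OF t] by simp
qed

lemma solution_unique:
  assumes x: "solution_on f D t0 p \<infinity> x" and y: "solution_on f D t0 p \<infinity> y"
    and p: "p \<in> N" and "t0 \<le> t"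
  shows "x t = y t"
proof (rule solution_on_infinity_unique[OF x y _ \<open>t0 \<le> t\<close>])
  fix t assume t: "t0 \<le> t" "x t = y t"
  show "(\<forall>s\<ge>t. x s = y s) \<or> (\<exists>L U. open U \<and> x t \<in> U \<and> L-lipschitz_on U f)"
  proof (cases "x t = \<tau>")
    case True
    then show ?thesis
      using solution_absorbed[OF x p] solution_absorbed[OF y p] t by auto
  next
    case False
    have "x t \<in> N"
      using solution_in_N[OF x p t(1)] .
    then have "lipschitz_near f (x t)"
      using False by (intro lipschitz_near_f G_nonzero) (auto simp: N_def)
    then show ?thesis
      by (simp add: lipschitz_near_def)
  qed
qed

lemma unique_solution:
  assumes x: "solution_on f D t0 p \<infinity> x" and p: "p \<in> N"
  shows "unique_right_maximal_solution f D t0 p \<infinity> x"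
  unfolding unique_right_maximal_solution_def
proof (intro conjI allI impI)
  show "right_maximal_solution f D t0 p \<infinity> x"
    using x by (rule right_maximal_solution_infinity)
  \<comment> \<open>Every competing maximal solution is global, so only solutions on the same
    half-line have to be compared.\<close>
  fix b y assume y: "right_maximal_solution f D t0 p b y"
  show b: "b = \<infinity>"
    using right_maximal_solution_global[OF y] p N_subset_S by auto
  show "\<forall>t\<in>right_interval t0 \<infinity>. y t = x t"
    using y b by (auto intro!: solution_unique[OF _ x p] simp: right_maximal_solution_def)
qed

section \<open>Arrival at the goal in finite time, and stability\<close>

lemma reaches_goal:
  assumes sol: "solution_on f D 0 p \<infinity> x" and p: "p \<in> N"
  shows "\<exists>t\<ge>0. x t = \<tau>"
proof (rule ccontr)
  assume contra: "\<not> (\<exists>t\<ge>0. x t = \<tau>)"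
  \<comment> \<open>\<open>m\<close> bounds the denominator along the trajectory, which gives
    \<open>B / m \<le> (norm G)^2\<close>. Raising this to the power \<beta> produces
    \<open>norm G powr (\<alpha> + 1)\<close> on the right, and \<kappa> collects the
    constants.\<close>
  define m where "m = R (B p) + norm (obs - \<tau>) + 1"
  define \<beta> where "\<beta> = (\<alpha> + 1) / 2"
  define \<kappa> where "\<kappa> = k1 * m powr (- \<beta>)"
  have \<beta>: "0 < \<beta>" "\<beta> < 1"
    using \<alpha>_pos \<alpha>_less_1 by (auto simp: \<beta>_def)
  have Np: "x t \<in> N" if "0 \<le> t" for t
    using solution_in_N[OF sol p] that by simp
  have safe: "dc \<le> norm (x t - obs)" if "0 \<le> t" for t
    using Np[OF that] by (simp add: N_def)
  have den_m: "den (x t) < m" if "0 \<le> t" for t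
    using solution_stays[OF sol, of t] den_le[of "x t"] that p N_subset_S
    by (auto simp: W_def m_def)
  have "0 < m"
    using den_m[of 0] den_pos[OF safe[of 0]] by simp
  then have "0 < \<kappa>"
    using k1_pos by (simp add: \<kappa>_def)
  have contx: "continuous_on {0..T} x" for T
    by (rule continuous_on_subset[OF solution_on_continuous_on[OF sol]]) auto
  have bound: "(1 - \<beta>) * \<kappa> * T \<le> B (x 0) powr (1 - \<beta>)" if "0 \<le> T" for T
  proof (rule sublinear_decay_bound[OF \<open>0 \<le> T\<close> \<beta>(2)])
    show "continuous_on {0..T} (\<lambda>t. B (x t))"
      by (rule continuous_on_compose2[OF continuous_on_B contx]) (use in_D safe in auto)
    show "0 < B (x t)" if "t \<in> {0..T}" for t
      using that contra B_nonneg[OF safe[of t]] B_eq_0_iff[OF safe[of t]]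
      by (auto simp: order.order_iff_strict)
    fix t assume "t \<in> {0<..<T}"
    then have t: "0 < t" by simp
    have "((\<lambda>t. B (x t)) has_field_derivative - k1 * norm (G (x t)) powr (\<alpha> + 1)) (at t)"
      using t by (intro B_derivative in_D safe solution_on_has_vector_derivative_at[OF sol]) auto
    moreover have "- k1 * norm (G (x t)) powr (\<alpha> + 1) \<le> - \<kappa> * B (x t) powr \<beta>"
    proof -
      have pos: "0 < den (x t)" and nonneg: "0 \<le> B (x t)"
        using den_pos[OF safe] B_nonneg[OF safe] t by auto
      have "B (x t) / m \<le> B (x t) / den (x t)"
        using pos nonneg den_m[of t] t by (intro divide_left_mono) auto
      also have "\<dots> = (norm (x t - \<tau>) / den (x t))\<^sup>2"
        using norm_sq_eq_B[OF safe[of t]] t pos by (simp add: power_divide power2_eq_square)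
      also have "\<dots> \<le> (norm (G (x t)))\<^sup>2"
        using norm_G_ge[OF Np[of t]] t pos by (intro power_mono) auto
      finally have "(B (x t) / m) powr \<beta> \<le> ((norm (G (x t)))\<^sup>2) powr \<beta>"
        using \<beta> nonneg \<open>0 < m\<close> by (intro powr_mono2) auto
      also have "\<dots> = norm (G (x t)) powr (\<alpha> + 1)"
      proof -
        have "(norm (G (x t)))\<^sup>2 = norm (G (x t)) powr 2"
          by simp
        moreover have "2 * \<beta> = \<alpha> + 1"
          by (simp add: \<beta>_def)
        ultimately show ?thesis
          by (simp only: powr_powr)
      qed
      finally have "k1 * (B (x t) / m) powr \<beta> \<le> k1 * norm (G (x t)) powr (\<alpha> + 1)"
        using k1_pos by simp
      then show ?thesis
        using nonneg \<open>0 < m\<close> by (simp add: \<kappa>_def powr_divide powr_minus field_simps)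
    qed
    ultimately show "((\<lambda>t. B (x t)) has_field_derivative - k1 * norm (G (x t)) powr (\<alpha> + 1)) (at t)
        \<and> - k1 * norm (G (x t)) powr (\<alpha> + 1) \<le> - \<kappa> * B (x t) powr \<beta>" ..
  qed
  \<comment> \<open>A time for which \<open>bound\<close> would read
    \<open>X + 1 \<le> X\<close>.\<close>
  let ?T = "(B (x 0) powr (1 - \<beta>) + 1) / ((1 - \<beta>) * \<kappa>)"
  have "0 < (1 - \<beta>) * \<kappa>"
    using \<beta> \<open>0 < \<kappa>\<close> by simp
  then have "(1 - \<beta>) * \<kappa> * ?T = B (x 0) powr (1 - \<beta>) + 1" "0 \<le> ?T"
    by (auto intro!: divide_nonneg_pos add_nonneg_nonneg)
  with bound[of ?T] show False by linarith
qed

lemma first_hitting_time: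
  assumes sol: "solution_on f D 0 p \<infinity> x" and p: "p \<in> N" "p \<noteq> \<tau>"
  shows "\<exists>T>0. x T = \<tau> \<and> (\<forall>t\<in>{0..<T}. x t \<noteq> \<tau>)"
proof -
  obtain t1 where t1: "0 \<le> t1" "x t1 = \<tau>"
    using reaches_goal[OF sol p(1)] by blast
  define A where "A = {t \<in> {0..t1}. x t = \<tau>}"
  have "continuous_on {0..t1} x"
    by (rule continuous_on_subset[OF solution_on_continuous_on[OF sol]]) auto
  then have "compact A"
    unfolding A_def by (intro closedin_compact[OF compact_Icc continuous_closedin_preimage_constant])
  moreover have "A \<noteq> {}"
    using t1 by (auto simp: A_def)
  ultimately obtain T where T: "T \<in> A" and min: "\<And>t. t \<in> A \<Longrightarrow> T \<le> t"
    using compact_attains_inf[of A] by auto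
  have "T \<noteq> 0"
    using T sol p(2) by (auto simp: A_def solution_on_def)
  then have "0 < T" "x T = \<tau>"
    using T by (auto simp: A_def)
  moreover have "x t \<noteq> \<tau>" if "t \<in> {0..<T}" for t
    using min[of t] that T by (auto simp: A_def)
  ultimately show ?thesis by blast
qed

lemma finite_time_stable: "finite_time_stable_equilibrium f D \<tau>"
proof -
  have "\<forall>p\<in>N. \<exists>x. solution_on f D 0 p \<infinity> x"
    using global_solution N_subset_S by blast
  then obtain \<psi> where \<psi>: "\<And>p. p \<in> N \<Longrightarrow> solution_on f D 0 p \<infinity> (\<psi> p)"
    by metis
  have "\<forall>p\<in>N - {\<tau>}. \<exists>T>0. \<psi> p T = \<tau> \<and> (\<forall>t\<in>{0..<T}. \<psi> p t \<noteq> \<tau>)"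
    using first_hitting_time[OF \<psi>] by blast
  then obtain T where T: "\<And>p. p \<in> N - {\<tau>} \<Longrightarrow>
      0 < T p \<and> \<psi> p (T p) = \<tau> \<and> (\<forall>t\<in>{0..<T p}. \<psi> p t \<noteq> \<tau>)"
    by metis
  have "(\<psi> p \<longlongrightarrow> \<tau>) (at_left (T p))" if p: "p \<in> N - {\<tau>}" for p
  proof -
    have "isCont (\<psi> p) (T p)"
      using solution_on_has_vector_derivative_at[OF \<psi>, of p "T p"] p T[OF p]
      by (intro has_vector_derivative_continuous) auto
    then have "(\<psi> p \<longlongrightarrow> \<psi> p (T p)) (at (T p))"
      by (simp add: isCont_def)
    then show ?thesis
      using T[OF p] by (metis filterlim_at_split)
  qed
  moreover have "\<exists>V. open V \<and> V \<subseteq> N \<and> \<tau> \<in> V \<and> (\<forall>p\<in>V - {\<tau>}. \<forall>t\<in>{0..<T p}. \<psi> p t \<in> U)"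
    if U: "open U" "\<tau> \<in> U" for U
  proof -
    obtain e where "0 < e" and e: "ball \<tau> e \<subseteq> U"
      using U by (auto simp: open_contains_ball)
    define m where "m = R (dc / 2) + norm (obs - \<tau>) + 1"
    have "0 < m"
      using dc_pos norm_ge_zero[of "obs - \<tau>"] unfolding m_def R_def by linarith
    \<comment> \<open>The squared distance to the goal is \<open>B\<close> times the denominator.
      From a start with \<open>B p < c\<close> the first factor stays below \<open>c\<close> and the
      second is at most \<open>m\<close>, so the solution stays within \<open>e\<close> of the
      goal.\<close>
    define c where "c = min (dc / 2) (e\<^sup>2 / m)"
    have c: "0 < c" "c \<le> dc / 2" "c * m \<le> e\<^sup>2"
      using \<open>0 < m\<close> \<open>0 < e\<close> dc_pos by (auto simp: c_def min_def field_simps)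
    define V where "V = {x. dc < norm (x - obs) \<and> B x < c}"
    have "V \<subseteq> N"
      using c by (auto simp: V_def N_def)
    have "\<psi> p t \<in> U" if p: "p \<in> V" and t: "0 \<le> t" for p t
    proof -
      let ?x = "\<psi> p t"
      have pN: "p \<in> N" and pS: "p \<in> S"
        using p \<open>V \<subseteq> N\<close> N_subset_S by auto
      have x: "?x \<in> W (B p)" "B ?x \<le> B p"
        using solution_stays[OF \<psi>[OF pN] pS, of t] t by auto
      then have safe: "dc \<le> norm (?x - obs)" and "norm (?x - \<tau>) < R (B p)"
        by (auto simp: W_def)
      moreover have "R (B p) \<le> R (dc / 2)"
        using p c by (simp add: R_def V_def)
      ultimately have "den ?x \<le> m"
        using den_le[of ?x] by (simp add: m_def)
      have "(norm (?x - \<tau>))\<^sup>2 = B ?x * den ?x"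
        using norm_sq_eq_B[OF safe] .
      also have "\<dots> \<le> B ?x * m"
        using \<open>den ?x \<le> m\<close> B_nonneg[OF safe] by (intro mult_left_mono)
      also have "\<dots> < c * m"
        using x(2) p \<open>0 < m\<close> by (intro mult_strict_right_mono) (auto simp: V_def)
      finally have "(norm (?x - \<tau>))\<^sup>2 < e\<^sup>2"
        using c(3) by simp
      then have "norm (?x - \<tau>) < e"
        by (rule power_less_imp_less_base) (use \<open>0 < e\<close> in simp)
      then show ?thesis
        using e by (auto simp: dist_norm norm_minus_commute)
    qed
    moreover have "open V" "\<tau> \<in> V"
      using open_sublevel goal_clear c by (auto simp: V_def)
    ultimately show ?thesis
      using \<open>V \<subseteq> N\<close> by (intro exI[of _ V]) auto
  qed
  moreover have "\<psi> p t \<in> N - {\<tau>}" if "p \<in> N - {\<tau>}" "t \<in> {0..<T p}" for p t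
    using solution_in_N[OF \<psi>, of p t] T that by auto
  moreover have "N \<subseteq> D"
    by (auto simp: N_def in_D)
  ultimately show ?thesis
    unfolding finite_time_stable_equilibrium_def
    using open_D open_N goal_in_N f_goal T unique_solution[OF \<psi>]
    by (intro conjI exI[of _ N] exI[of _ T] exI[of _ "\<lambda>_. \<infinity>"] exI[of _ \<psi>]) auto
qed

end

theorem theorem5:
  fixes \<tau> obs x0 :: "real ^ 'n" and dc k1 \<alpha> t0 :: real
  assumes "dc > 0"
    and "norm (obs - \<tau>) > 2 * dc"
    and "k1 > 0"
    and "0 < \<alpha>" and "\<alpha> < 1"
    and "norm (x0 - obs) > dc"
  shows "\<exists>\<epsilon>0>0. \<forall>\<epsilon>\<ge>\<epsilon>0.
    finite_time_stable_equilibrium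
      (control_law k1 \<alpha> \<tau> obs dc \<epsilon>) (closed_loop_domain obs dc \<epsilon>) \<tau> \<and>
    (\<exists>b x. right_maximal_solution
      (control_law k1 \<alpha> \<tau> obs dc \<epsilon>) (closed_loop_domain obs dc \<epsilon>) t0 x0 b x) \<and>
    (\<forall>b x. right_maximal_solution
      (control_law k1 \<alpha> \<tau> obs dc \<epsilon>) (closed_loop_domain obs dc \<epsilon>) t0 x0 b x \<longrightarrow>
      b = \<infinity> \<and> (\<forall>t\<ge>t0. norm (x t - obs) \<ge> dc))"
proof -
  \<comment> \<open>An upper bound for \<open>B x0\<close> that does not depend on \<epsilon>:
    dropping \<open>1 / \<epsilon>\<close> only makes the denominator smaller.\<close>
  define c where "c = (norm (x0 - \<tau>))\<^sup>2 / (norm (x0 - obs) - dc)"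
  \<comment> \<open>The three terms provide the two bounds of the locale and
    \<open>c < dc\<^sup>2 * \<epsilon>\<close>, which places \<open>x0\<close> in
    \<open>S\<close>.\<close>
  define \<epsilon>0 where "\<epsilon>0 = max 1 (max (1 / dc) ((c + 1) / dc\<^sup>2))"
  show ?thesis
  proof (rule exI[of _ \<epsilon>0], rule conjI)
    show "0 < \<epsilon>0" by (simp add: \<epsilon>0_def)
    show "\<forall>\<epsilon>\<ge>\<epsilon>0.
      finite_time_stable_equilibrium
        (control_law k1 \<alpha> \<tau> obs dc \<epsilon>) (closed_loop_domain obs dc \<epsilon>) \<tau> \<and>
      (\<exists>b x. right_maximal_solution
        (control_law k1 \<alpha> \<tau> obs dc \<epsilon>) (closed_loop_domain obs dc \<epsilon>) t0 x0 b x) \<and>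
      (\<forall>b x. right_maximal_solution
        (control_law k1 \<alpha> \<tau> obs dc \<epsilon>) (closed_loop_domain obs dc \<epsilon>) t0 x0 b x \<longrightarrow>
        b = \<infinity> \<and> (\<forall>t\<ge>t0. norm (x t - obs) \<ge> dc))"
    proof (intro allI impI)
      fix \<epsilon> assume "\<epsilon>0 \<le> \<epsilon>"
      then have \<epsilon>: "1 \<le> \<epsilon>" "1 / dc \<le> \<epsilon>" "(c + 1) / dc\<^sup>2 \<le> \<epsilon>"
        by (auto simp: \<epsilon>0_def)
      interpret barrier_closed_loop \<tau> obs dc \<epsilon> k1 \<alpha>
        using assms \<epsilon> by unfold_locales (auto simp: field_simps)
      have "B x0 \<le> c"
        unfolding barrier_def c_def using assms \<epsilon>_inverse
        by (intro divide_left_mono mult_pos_pos add_pos_pos) auto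
      also have "c < dc\<^sup>2 * \<epsilon>"
        using \<epsilon>(3) assms(1) by (simp add: field_simps)
      finally have S: "x0 \<in> S"
        using assms by (simp add: S_def)
      have "\<exists>b x. right_maximal_solution f D t0 x0 b x"
        using global_solution[OF S] right_maximal_solution_infinity by metis
      moreover have "b = \<infinity> \<and> (\<forall>t\<ge>t0. dc \<le> norm (x t - obs))"
        if max: "right_maximal_solution f D t0 x0 b x" for b x
      proof -
        have b: "b = \<infinity>"
          by (rule right_maximal_solution_global[OF max S])
        then have "solution_on f D t0 x0 \<infinity> x"
          using max by (simp add: right_maximal_solution_def)
        then show ?thesis
          using b solution_stays(1)[OF _ S] by (fastforce simp: W_def)
      qed
      ultimately show "finite_time_stable_equilibrium f D \<tau> \<and>
          (\<exists>b x. right_maximal_solution f D t0 x0 b x) \<and>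
          (\<forall>b x. right_maximal_solution f D t0 x0 b x \<longrightarrow>
            b = \<infinity> \<and> (\<forall>t\<ge>t0. dc \<le> norm (x t - obs)))"
        using finite_time_stable by blast
    qed
  qed
qed

end
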